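(* Let $q$ be a prime power and let $t\geq 2$ be an integer. Then there exist Cameron-Liebler sets of generators on the Klein quadric $Q^+(5,q^t)$ with parameter $x=\frac{q^t-1}{q-1}$ arising from scattered $\mathbb{F}_q$-linear sets of rank $2t$ in $\mathrm{PG}(3,q^t)$. That is, there exists a scattered $\mathbb{F}_q$-linear set $P_0$ of rank $2t$ in $\mathrm{PG}(3,q^t)$ such that, if $P_2$ denotes the set of planes of $\mathrm{PG}(3,q^t)$ containing exactly $\frac{q^{t+1}-1}{q-1}$ points of $P_0$, then the set of generators of $Q^+(5,q^t)$ consisting of the Latin planes corresponding to the points of $P_0$ and the Greek planes corresponding to the planes of $P_2$ is a Cameron-Liebler set with parameter $x=\frac{q^t-1}{q-1}$.
   Context: For a prime power $Q$, the Klein quadric $Q^+(5,Q)$ is the hyperbolic quadric in $\mathrm{PG}(5,Q)$ with equation $X_0X_5+X_1X_4+X_2X_3=0$. Its generators are the planes of $\mathrm{PG}(5,Q)$ contained in it. The Klein correspondence is the bijection from lines of $\mathrm{PG}(3,Q)$ to points of $Q^+(5,Q)$ sending a line to its Plücker coordinates $(p_{01},p_{02},p_{03},p_{12},p_{31},p_{23})$. The set of all lines through a fixed point of $\mathrm{PG}(3,Q)$ is mapped onto a generator, called a Latin plane, and the set of all lines in a fixed plane of $\mathrm{PG}(3,Q)$ is mapped onto a generator, called a Greek plane; every generator arises in exactly one of these ways. Let $A$ be the $\{0,1\}$-valued point-generator incidence matrix of $Q^+(5,Q)$ (rows indexed by points, columns by generators, entry $1$ iff the point lies in the generator). A set $\mathcal{L}$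 of generators of $Q^+(5,Q)$ is a (degree one) Cameron-Liebler set if its characteristic vector (a real vector indexed by the generators) lies in $\mathrm{Im}(A^T)$ (over the reals); it has parameter $x$ if $|\mathcal{L}|=2x(Q+1)$. In $Q^+(5,Q)$ the notions of Cameron-Liebler set and degree one Cameron-Liebler set coincide. An $\mathbb{F}_q$-linear set of rank $k$ in $\mathrm{PG}(3,q^t)$ is a set of points of the form $\{\langle u\rangle_{\mathbb{F}_{q^t}} : u\in U\setminus\{0\}\}$, where $U$ is a $k$-dimensional $\mathbb{F}_q$-subspace of $\mathbb{F}_{q^t}^4$. It is scattered (with respect to $U$) if $U$ meets every one-dimensional $\mathbb{F}_{q^t}$-subspace of $\mathbb{F}_{q^t}^4$ in an $\mathbb{F}_q$-subspace of dimension at most $1$, i.e. if it has exactly $\frac{q^k-1}{q-1}$ points. *)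

theory Defs
  imports "HOL-Analysis.Analysis" "HOL-Number_Theory.Prime_Powers"
begin

(* Subspaces of PG(n-1,K) are represented by the corresponding K-subspaces of K^n, as sets of
   vectors; d is the vector space dimension, i.e. one more than the projective dimension. *)
definition proj_subspaces :: "nat \<Rightarrow> ('k::field ^ 'n) set set" where
  "proj_subspaces d = {S. vec.subspace S \<and> vec.dim S = d}"

abbreviation "proj_points \<equiv> proj_subspaces 1"
abbreviation "proj_lines \<equiv> proj_subspaces 2"
abbreviation "proj_planes \<equiv> proj_subspaces 3"

(* The index types 4 and 6 consist of the residues 0, ..., 3 and 0, ..., 5. *)
definition klein_form :: "'k::field ^ 6 \<Rightarrow> 'k" where
  "klein_form X = X $ 0 * X $ 5 + X $ 1 * X $ 4 + X $ 2 * X $ 3"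

definition klein_points :: "('k::field ^ 6) set set" where
  "klein_points = {P \<in> proj_points. \<forall>X\<in>P. klein_form X = 0}"

definition klein_generators :: "('k::field ^ 6) set set" where
  "klein_generators = {G \<in> proj_planes. \<forall>X\<in>G. klein_form X = 0}"

definition pluecker :: "'k::field ^ 4 \<Rightarrow> 'k ^ 4 \<Rightarrow> 'k ^ 6" where
  "pluecker u v =
     (let p = (\<lambda>i j. u $ i * v $ j - u $ j * v $ i) in
      \<chi> m. if m = 0 then p 0 1 else if m = 1 then p 0 2 else if m = 2 then p 0 3
           else if m = 3 then p 1 2 else if m = 4 then p 3 1 else p 2 3)"

(* Vectors u, v spanning L determine pluecker u v up to a nonzero scalar, and
   pluecker u v = 0 for dependent u, v; so the span is the point given by the
   Pluecker coordinates of L. *)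
definition klein_corr :: "('k::field ^ 4) set \<Rightarrow> ('k ^ 6) set" where
  "klein_corr L = vec.span {pluecker u v | u v. u \<in> L \<and> v \<in> L}"

(* A set of points of PG(5,K) is turned into a set of vectors by taking the union. *)
definition latin_plane :: "('k::field ^ 4) set \<Rightarrow> ('k ^ 6) set" where
  "latin_plane P = \<Union> (klein_corr ` {L \<in> proj_lines. P \<subseteq> L})"

definition greek_plane :: "('k::field ^ 4) set \<Rightarrow> ('k ^ 6) set" where
  "greek_plane E = \<Union> (klein_corr ` {L \<in> proj_lines. L \<subseteq> E})"

definition incidence :: "('k::field ^ 6) set \<Rightarrow> ('k ^ 6) set \<Rightarrow> real" where
  "incidence P G = (if P \<subseteq> G then 1 else 0)"

(* The witness f is a real vector indexed by the points, mapped by the transposed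
   point-generator incidence matrix to the characteristic vector of \<L>. *)
definition cameron_liebler :: "('k::{field,finite} ^ 6) set set \<Rightarrow> bool" where
  "cameron_liebler \<L> \<longleftrightarrow> \<L> \<subseteq> klein_generators \<and>
     (\<exists>f :: ('k ^ 6) set \<Rightarrow> real. \<forall>G\<in>klein_generators.
        indicator \<L> G = (\<Sum>P\<in>klein_points. incidence P G * f P))"

definition has_parameter :: "('k::{field,finite} ^ 6) set set \<Rightarrow> real \<Rightarrow> bool" where
  "has_parameter \<L> x \<longleftrightarrow> real (card \<L>) = 2 * x * (real CARD('k) + 1)"

definition field_embedding :: "('f::field \<Rightarrow> 'k::field) \<Rightarrow> bool" where
  "field_embedding \<iota> \<longleftrightarrow> \<iota> 1 = 1 \<and> (\<forall>a b. \<iota> (a + b) = \<iota> a + \<iota> b) \<and> (\<forall>a b. \<iota> (a * b) = \<iota> a * \<iota> b)"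

(* Restriction of scalars: K^n as a vector space over the subfield given by the embedding. *)
definition scale_via :: "('f::field \<Rightarrow> 'k::field) \<Rightarrow> 'f \<Rightarrow> 'k ^ 'n \<Rightarrow> 'k ^ 'n" where
  "scale_via \<iota> a v = \<iota> a *s v"

lemma vector_space_scale_via:
  assumes "field_embedding \<iota>"
  shows "vector_space (scale_via \<iota> :: _ \<Rightarrow> 'k::field ^ 'n \<Rightarrow> 'k ^ 'n)"
  using assms
  by unfold_locales (auto simp: field_embedding_def scale_via_def vec_eq_iff algebra_simps)

definition linear_set :: "('k::field ^ 'n) set \<Rightarrow> ('k ^ 'n) set set" where
  "linear_set U = {vec.span {u} | u. u \<in> U - {0}}"

definition scattered_linear_set ::
    "('f::field \<Rightarrow> 'k::field) \<Rightarrow> nat \<Rightarrow> ('k ^ 'n) set set \<Rightarrow> bool" where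
  "scattered_linear_set \<iota> k \<P> \<longleftrightarrow>
     (\<exists>U. module.subspace (scale_via \<iota>) U \<and> vector_space.dim (scale_via \<iota>) U = k \<and>
          (\<forall>S\<in>proj_points. vector_space.dim (scale_via \<iota>) (U \<inter> S) \<le> 1) \<and>
          \<P> = linear_set U)"

end

theory Submission
  imports Defs "HOL-Number_Theory.Residues"
begin

text \<open>
  Write \<open>K\<close> for the large field, \<open>Q\<close> for its order \<open>q ^ t\<close> and \<open>m\<close> for \<open>(Q - 1) / (q - 1)\<close>. The proof joins
  two independent facts.

  The subspace \<open>U\<close> of all vectors \<open>(x, x ^ q, y, y ^ q)\<close> over the small field is scattered, since a
  scalar that maps a nonzero vector of \<open>U\<close> into \<open>U\<close> is fixed by the \<open>q\<close>-th power map and hence lies in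
  the small field. Its linear set therefore has \<open>(Q ^ 2 - 1) / (q - 1) = m * (Q + 1)\<close> points. A plane
  cuts \<open>U\<close> in the kernel of a map to \<open>K\<close>, and as a nonzero map taking \<open>x\<close> to \<open>b * x + c * x ^ q\<close> has at most \<open>q\<close> zeros, this kernel has
  order \<open>Q\<close> or \<open>q * Q\<close> (lemma \<open>card_U_Int_annihilator\<close>). So a plane contains \<open>m\<close> or
  \<open>m + Q = (q ^ (t + 1) - 1) / (q - 1)\<close> points of the linear set.

  Any set of \<open>m * (Q + 1)\<close> points that planes meet in \<open>m\<close> or \<open>m + Q\<close> points gives a Cameron-Liebler set
  (lemmas \<open>cameron_liebler_L\<close> and \<open>has_parameter_L\<close>). The points of the Klein quadric are lines,
  and the witness assigns to a line the number of its points in the set, shifted and scaled. Summing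
  over the lines through a point or in a plane counts incidences, and the hypothesis on the
  intersection numbers makes the surplus of the chosen points equal to that of the chosen planes.
  The parameter follows by counting the chosen planes.

  That these two kinds of sums exhaust all generators is the classification \<open>klein_generators_iff\<close>. It is
  derived here from the Clifford relation between the joining and the meeting operator of a bivector
  (lemma \<open>totally_singular_annihilates_spinor\<close>): a totally singular subspace kills a point or a
  plane.
\<close>

section \<open>Counting in finite vector spaces\<close>

lemma card_eq_fibre_card_times_image:
  assumes "finite A" and "\<And>y. y \<in> h ` A \<Longrightarrow> card {x \<in> A. h x = y} = n"
  shows "card A = card (h ` A) * n"
proof -
  have "card A = (\<Sum>y\<in>h ` A. \<Sum>x\<in>{x \<in> A. h x = y}. 1)"
    using sum.image_gen[OF assms(1), of "\<lambda>_. 1::nat" h] by simp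
  also have "\<dots> = (\<Sum>y\<in>h ` A. n)"
    by (intro sum.cong) (simp_all add: assms(2))
  finally show ?thesis by simp
qed

lemma card_additive_kernel_image:
  fixes h :: "'a::ab_group_add \<Rightarrow> 'b::ab_group_add"
  assumes "finite S" and add: "\<And>x y. x \<in> S \<Longrightarrow> y \<in> S \<Longrightarrow> x + y \<in> S"
    and diff: "\<And>x y. x \<in> S \<Longrightarrow> y \<in> S \<Longrightarrow> x - y \<in> S"
    and h: "\<And>x y. h (x + y) = h x + h y"
  shows "card S = card (h ` S) * card {x \<in> S. h x = 0}"
proof (rule card_eq_fibre_card_times_image[OF assms(1)])
  fix y assume "y \<in> h ` S"
  then obtain x0 where x0: "x0 \<in> S" "y = h x0" by auto
  have h_diff: "h (x - x') = h x - h x'" for x x'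
    using h[of "x - x'" x'] by (simp add: algebra_simps)
  have "bij_betw (\<lambda>x. x - x0) {x \<in> S. h x = y} {x \<in> S. h x = 0}"
    by (rule bij_betw_byWitness[where f' = "\<lambda>x. x + x0"])
      (use x0 in \<open>auto simp: h h_diff intro: add diff\<close>)
  then show "card {x \<in> S. h x = y} = card {x \<in> S. h x = 0}"
    by (rule bij_betw_same_card)
qed

lemma (in vector_space) card_subspace:
  assumes "finite (UNIV :: 'a set)" and "subspace S" and "finite S"
  shows "card S = card (UNIV :: 'a set) ^ dim S"
proof -
  obtain B where B: "B \<subseteq> S" "independent B" "S \<subseteq> span B" "card B = dim S"
    by (rule basis_exists)
  have "finite B" using B(1) assms(3) by (rule finite_subset)
  have S: "S = span B"
    using B(1,3) assms(2) span_minimal by blast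
  define h where "h = (\<lambda>u. \<Sum>v\<in>B. scale (u v) v)"
  have "S = h ` (B \<rightarrow>\<^sub>E UNIV)"
  proof -
    have "h u = h (restrict u B)" for u by (simp add: h_def)
    then have "h u \<in> h ` (B \<rightarrow>\<^sub>E UNIV)" for u
      by (metis image_eqI restrict_PiE_iff UNIV_I)
    then show ?thesis
      unfolding S span_finite[OF \<open>finite B\<close>] h_def[symmetric] by auto
  qed
  moreover have "inj_on h (B \<rightarrow>\<^sub>E UNIV)"
  proof (rule inj_onI)
    fix f g assume fg: "f \<in> B \<rightarrow>\<^sub>E UNIV" "g \<in> B \<rightarrow>\<^sub>E UNIV" "h f = h g"
    then have "(\<Sum>v\<in>B. scale (f v - g v) v) = 0"
      by (simp add: h_def scale_left_diff_distrib sum_subtractf)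
    then have "f v = g v" if "v \<in> B" for v
      using independentD[OF B(2) \<open>finite B\<close> order_refl _ that, of "\<lambda>v. f v - g v"] by simp
    then show "f = g" using fg(1,2) by (intro PiE_ext) auto
  qed
  ultimately have "card S = card (B \<rightarrow>\<^sub>E (UNIV :: 'a set))"
    by (simp add: card_image)
  then show ?thesis
    using \<open>finite B\<close> B(4) by (simp add: card_PiE)
qed

lemma CARD_field_gt_1: "CARD('k::{field,finite}) > 1"
proof -
  have "card {0, 1 :: 'k} \<le> CARD('k)" by (rule card_mono) auto
  then show ?thesis by simp
qed

lemma card_vec_subspace:
  fixes S :: "('k::{field,finite} ^ 'n) set"
  assumes "vec.subspace S"
  shows "card S = CARD('k) ^ vec.dim S"
  using vec.card_subspace[OF _ assms] by simp

lemma vec_dim_eq_iff_card: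
  fixes S :: "('k::{field,finite} ^ 'n) set"
  assumes "vec.subspace S"
  shows "vec.dim S = d \<longleftrightarrow> card S = CARD('k) ^ d"
  using card_vec_subspace[OF assms] power_inject_exp[OF CARD_field_gt_1[where 'k='k]] by auto

lemma in_proj_subspaces_iff:
  fixes S :: "('k::{field,finite} ^ 'n) set"
  shows "S \<in> proj_subspaces d \<longleftrightarrow> vec.subspace S \<and> card S = CARD('k) ^ d"
  unfolding proj_subspaces_def using vec_dim_eq_iff_card by blast

lemma vec_subspace_eqI:
  fixes S T :: "('k::{field,finite} ^ 'n) set"
  assumes "S \<subseteq> T" "card S = card T"
  shows "S = T"
  by (rule card_subset_eq) (use assms in auto)

lemma card_span_singleton:
  fixes x :: "'k::{field,finite} ^ 'n"
  assumes "x \<noteq> 0"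
  shows "card (vec.span {x}) = CARD('k)"
proof -
  have "vec.dim (vec.span {x}) = 1"
    using assms by (simp add: vec.dim_span_eq_card_independent)
  then show ?thesis using card_vec_subspace[OF vec.subspace_span, of "{x}"] by simp
qed

lemma span_singleton_eq_iff:
  fixes x y :: "'k::{field,finite} ^ 'n"
  assumes "x \<noteq> 0" "y \<noteq> 0"
  shows "vec.span {x} = vec.span {y} \<longleftrightarrow> x \<in> vec.span {y}"
proof
  assume "x \<in> vec.span {y}"
  then have "vec.span {x} \<subseteq> vec.span {y}" by (simp add: vec.span_minimal)
  then show "vec.span {x} = vec.span {y}"
    by (rule vec_subspace_eqI) (simp add: assms card_span_singleton)
qed (auto intro: vec.span_base)

lemma proj_points_iff:
  fixes P :: "('k::{field,finite} ^ 'n) set"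
  shows "P \<in> proj_points \<longleftrightarrow> (\<exists>x. x \<noteq> 0 \<and> P = vec.span {x})"
proof
  assume P: "P \<in> proj_points"
  then have "vec.subspace P" "card P = CARD('k)" by (auto simp: in_proj_subspaces_iff)
  have "\<exists>x\<in>P. x \<noteq> 0"
  proof (rule ccontr)
    assume "\<not> ?thesis"
    then have "P \<subseteq> {0}" by auto
    then have "card P \<le> 1" using card_mono[of "{0}" P] by simp
    then show False using \<open>card P = _\<close> CARD_field_gt_1[where 'k='k] by simp
  qed
  then obtain x where x: "x \<in> P" "x \<noteq> 0" by blast
  have "vec.span {x} = P"
    using x \<open>vec.subspace P\<close> \<open>card P = _\<close>
    by (intro vec_subspace_eqI vec.span_minimal) (auto simp: card_span_singleton)
  then show "\<exists>x. x \<noteq> 0 \<and> P = vec.span {x}" using x by blast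
qed (auto simp: in_proj_subspaces_iff card_span_singleton)

lemma linear_set_subset_proj_points:
  "linear_set W \<subseteq> (proj_points :: ('k::{field,finite} ^ 'n) set set)"
  using proj_points_iff by (fastforce simp: linear_set_def)

lemma points_in_subspace_linear_set:
  fixes P :: "('k::{field,finite} ^ 'n) set"
  assumes "vec.subspace E"
  shows "{P \<in> linear_set W. P \<subseteq> E} = linear_set (W \<inter> E)"
proof -
  have "vec.span {u} \<subseteq> E \<longleftrightarrow> u \<in> E" for u
    using assms vec.span_base[of u "{u}"] vec.span_minimal[of "{u}" E] by auto
  then show ?thesis by (auto simp: linear_set_def)
qed

lemma proj_points_eq_linear_set: "proj_points = linear_set (UNIV :: ('k::{field,finite} ^ 'n) set)"
  unfolding linear_set_def using proj_points_iff by blast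

text \<open>
  Two vectors of \<open>W\<close> span the same point iff one lies on the span of the other, so each point of the
  linear set accounts for the \<open>n - 1\<close> nonzero vectors of \<open>W\<close> on it. With \<open>W\<close> a subspace this counts
  the points of a projective subspace; with \<open>W\<close> a scattered subspace over the smaller field it counts
  the points of a scattered linear set.
\<close>
lemma card_linear_set:
  fixes W :: "('k::{field,finite} ^ 'n) set"
  assumes "0 \<in> W" and "\<And>x. x \<in> W \<Longrightarrow> x \<noteq> 0 \<Longrightarrow> card (W \<inter> vec.span {x}) = n"
  shows "card (linear_set W) * (n - 1) = card W - 1"
proof -
  have img: "linear_set W = (\<lambda>x. vec.span {x}) ` (W - {0})"
    by (auto simp: linear_set_def)
  have "card (W - {0}) = card ((\<lambda>x. vec.span {x}) ` (W - {0})) * (n - 1)"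
  proof (rule card_eq_fibre_card_times_image)
    fix P assume "P \<in> (\<lambda>x. vec.span {x}) ` (W - {0})"
    then obtain y where y: "y \<in> W" "y \<noteq> 0" "P = vec.span {y}" by auto
    have "{x \<in> W - {0}. vec.span {x} = P} = W \<inter> vec.span {y} - {0}"
      using y span_singleton_eq_iff by blast
    then show "card {x \<in> W - {0}. vec.span {x} = P} = n - 1"
      using y assms by (simp add: card_Diff_singleton vec.span_zero)
  qed simp
  then show ?thesis using assms(1) img by simp
qed

lemma card_points_in_subspace:
  fixes W :: "('k::{field,finite} ^ 'n) set"
  assumes "vec.subspace W"
  shows "real (card {P \<in> proj_points. P \<subseteq> W}) = (real (card W) - 1) / (real CARD('k) - 1)"
proof -
  have "card (linear_set W) * (CARD('k) - 1) = card W - 1"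
  proof (rule card_linear_set)
    fix x assume "x \<in> W" "x \<noteq> 0"
    then have "W \<inter> vec.span {x} = vec.span {x}"
      using assms vec.span_minimal[of "{x}" W] by auto
    then show "card (W \<inter> vec.span {x}) = CARD('k)"
      using \<open>x \<noteq> 0\<close> by (simp add: card_span_singleton)
  qed (use assms vec.subspace_0 in auto)
  then have "real (card (linear_set W)) * (real CARD('k) - 1) = real (card W - 1)"
    using CARD_field_gt_1[where 'k='k] by (metis of_nat_1 of_nat_diff of_nat_mult less_imp_le)
  moreover have "card W \<ge> 1"
    using assms vec.subspace_0 by (metis One_nat_def Suc_leI card_gt_0_iff empty_iff finite)
  ultimately show ?thesis
    unfolding proj_points_eq_linear_set points_in_subspace_linear_set[OF assms]
    using CARD_field_gt_1[where 'k='k] by (simp add: field_simps of_nat_diff)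
qed

lemma nonzero_imp_dual_vector:
  fixes z :: "'k::field ^ 'n"
  assumes "z \<noteq> 0"
  obtains w where "(\<Sum>i\<in>UNIV. w $ i * z $ i) = 1"
proof -
  from assms obtain i where i: "z $ i \<noteq> 0" by (auto simp: vec_eq_iff)
  have "(\<Sum>j\<in>UNIV. (axis i (1 / z $ i)) $ j * z $ j) = (\<Sum>j\<in>UNIV. if j = i then 1 else 0)"
    using i by (intro sum.cong) (auto simp: axis_def)
  then show thesis using that by simp
qed

section \<open>Bivectors acting on points and planes\<close>

lemma UNIV_4_from_0: "(UNIV :: 4 set) = {0, 1, 2, 3}"
  by (rule sym, rule card_subset_eq) auto

lemma UNIV_6_from_0: "(UNIV :: 6 set) = {0, 1, 2, 3, 4, 5}"
  by (rule sym, rule card_subset_eq) auto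

lemma vec4_eq_iff:
  "(v :: 'a ^ 4) = w \<longleftrightarrow> v $ 0 = w $ 0 \<and> v $ 1 = w $ 1 \<and> v $ 2 = w $ 2 \<and> v $ 3 = w $ 3"
proof -
  have "(\<forall>i. v $ i = w $ i) \<longleftrightarrow> (\<forall>i\<in>{0, 1, 2, 3}. v $ i = w $ i)"
    unfolding UNIV_4_from_0[symmetric] by simp
  then show ?thesis by (simp add: vec_eq_iff)
qed

lemma vec6_eq_iff:
  "(v :: 'a ^ 6) = w \<longleftrightarrow> v $ 0 = w $ 0 \<and> v $ 1 = w $ 1 \<and> v $ 2 = w $ 2 \<and> v $ 3 = w $ 3 \<and>
     v $ 4 = w $ 4 \<and> v $ 5 = w $ 5"
proof -
  have "(\<forall>i. v $ i = w $ i) \<longleftrightarrow> (\<forall>i\<in>{0, 1, 2, 3, 4, 5}. v $ i = w $ i)"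
    unfolding UNIV_6_from_0[symmetric] by simp
  then show ?thesis by (simp add: vec_eq_iff)
qed

definition vec4 :: "'a \<Rightarrow> 'a \<Rightarrow> 'a \<Rightarrow> 'a \<Rightarrow> 'a ^ 4" where
  "vec4 a b c d = (\<chi> i. if i = 0 then a else if i = 1 then b else if i = 2 then c else d)"

lemma vec4_nth [simp]:
  "vec4 a b c d $ 0 = a" "vec4 a b c d $ 1 = b" "vec4 a b c d $ 2 = c" "vec4 a b c d $ 3 = d"
  by (simp_all add: vec4_def)

text \<open>
  A covector \<open>a\<close> is stored as a vector of the same type; the plane that it defines consists of
  the \<open>v\<close> with \<open>pairing a v = 0\<close>.
\<close>
definition pairing :: "'k::field ^ 4 \<Rightarrow> 'k ^ 4 \<Rightarrow> 'k" where
  "pairing a v = a $ 0 * v $ 0 + a $ 1 * v $ 1 + a $ 2 * v $ 2 + a $ 3 * v $ 3"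

text \<open>
  The contraction of the bivector \<open>X\<close> by the covector \<open>a\<close>, that is, the product of the skew matrix
  with the entries \<open>p\<^sub>i\<^sub>j\<close> and \<open>a\<close>. If \<open>X\<close> represents a line not contained in the plane \<open>a\<close>, then
  \<open>meet X a\<close> is the point where the line meets the plane.
\<close>
definition meet :: "'k::field ^ 6 \<Rightarrow> 'k ^ 4 \<Rightarrow> 'k ^ 4" where
  "meet X a = vec4
     (X $ 0 * a $ 1 + X $ 1 * a $ 2 + X $ 2 * a $ 3)
     (- X $ 0 * a $ 0 + X $ 3 * a $ 2 - X $ 4 * a $ 3)
     (- X $ 1 * a $ 0 - X $ 3 * a $ 1 + X $ 5 * a $ 3)
     (- X $ 2 * a $ 0 + X $ 4 * a $ 1 - X $ 5 * a $ 2)"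

text \<open>
  The interchange of complementary Pluecker coordinates, hence the action on lines of the standard
  duality of the projective space.
\<close>
definition hodge :: "'k ^ 6 \<Rightarrow> 'k ^ 6" where
  "hodge X = (\<chi> m. if m = 0 then X $ 5 else if m = 1 then X $ 4 else if m = 2 then X $ 3
           else if m = 3 then X $ 2 else if m = 4 then X $ 1 else X $ 0)"

text \<open>
  The exterior product of \<open>X\<close> and \<open>s\<close>, read as a covector: dually to \<open>meet\<close>, it is the plane joining a
  line to a point off the line.
\<close>
definition join :: "'k::field ^ 6 \<Rightarrow> 'k ^ 4 \<Rightarrow> 'k ^ 4" where
  "join X s = meet (hodge X) s"

lemma pluecker_nth:
  "pluecker u v $ 0 = u $ 0 * v $ 1 - u $ 1 * v $ 0"
  "pluecker u v $ 1 = u $ 0 * v $ 2 - u $ 2 * v $ 0"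
  "pluecker u v $ 2 = u $ 0 * v $ 3 - u $ 3 * v $ 0"
  "pluecker u v $ 3 = u $ 1 * v $ 2 - u $ 2 * v $ 1"
  "pluecker u v $ 4 = u $ 3 * v $ 1 - u $ 1 * v $ 3"
  "pluecker u v $ 5 = u $ 2 * v $ 3 - u $ 3 * v $ 2"
  by (simp_all add: pluecker_def)

lemma hodge_nth [simp]:
  "hodge X $ 0 = X $ 5" "hodge X $ 1 = X $ 4" "hodge X $ 2 = X $ 3"
  "hodge X $ 3 = X $ 2" "hodge X $ 4 = X $ 1" "hodge X $ 5 = X $ 0"
  by (simp_all add: hodge_def)

lemma hodge_hodge [simp]: "hodge (hodge X) = X"
  by (simp add: vec6_eq_iff)

lemma klein_form_hodge [simp]: "klein_form (hodge X) = klein_form X"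
  by (simp add: klein_form_def algebra_simps)

lemmas coordinates =
  vec4_eq_iff vec6_eq_iff pluecker_nth meet_def join_def klein_form_def pairing_def

lemma pairing_sum: "pairing a v = (\<Sum>i\<in>UNIV. a $ i * v $ i)"
  unfolding pairing_def UNIV_4_from_0 by simp

lemma pluecker_simps:
  fixes s v w :: "'k::field ^ 4"
  shows "pluecker s (v + w) = pluecker s v + pluecker s w"
    and "pluecker s (c *s v) = c *s pluecker s v"
    and "pluecker s (- v) = - pluecker s v"
    and "pluecker s 0 = 0" and "pluecker 0 s = 0" and "pluecker s s = 0"
  by (simp_all add: vec6_eq_iff pluecker_nth algebra_simps)

lemma meet_simps:
  fixes X Y :: "'k::field ^ 6"
  shows "meet (X + Y) v = meet X v + meet Y v" and "meet (c *s X) v = c *s meet X v"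
    and "meet 0 v = 0" and "meet X 0 = 0"
  by (simp_all add: vec4_eq_iff meet_def algebra_simps)

lemma hodge_simps:
  fixes X Y :: "'k::field ^ 6"
  shows "hodge (X + Y) = hodge X + hodge Y" and "hodge (c *s X) = c *s hodge X"
    and "hodge (0 :: 'k ^ 6) = 0"
  by (simp_all add: vec6_eq_iff)

lemma join_simps:
  fixes X Y :: "'k::field ^ 6"
  shows "join (X + Y) v = join X v + join Y v" and "join (c *s X) v = c *s join X v"
    and "join 0 v = 0" and "join X 0 = 0"
  by (simp_all add: join_def hodge_simps meet_simps)

lemma pairing_simps:
  "pairing a (v + w) = pairing a v + pairing a w" "pairing a (c *s v) = c * pairing a v"
  "pairing (v + w) a = pairing v a + pairing w a" "pairing (c *s v) a = c * pairing v a"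
  "pairing a 0 = 0" "pairing 0 a = 0"
  by (simp_all add: pairing_def algebra_simps)

text \<open>
  The operators \<open>join X\<close> (vectors to covectors) and \<open>meet X\<close> (covectors to vectors) together are the
  Clifford action of the 6-dimensional quadratic space on its spinor space, with vectors and
  covectors as the two kinds of half-spinors: \<open>X\<close> squares to minus its Klein form, and orthogonal
  \<open>X\<close>, \<open>Y\<close> anticommute. The classification of generators rests on this.
\<close>
lemma clifford_relation:
  "join X (meet Y a) + join Y (meet X a) = - ((klein_form (X + Y) - klein_form X - klein_form Y) *s a)"
  by (simp add: coordinates algebra_simps)

lemma clifford_square: "join X (meet X a) = - (klein_form X *s a)"
  by (simp add: coordinates algebra_simps)

text \<open>
  The Leibniz rule for contracting the exterior product of \<open>s\<close> and \<open>X\<close> by \<open>e\<close>. When the product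
  vanishes and \<open>pairing e s = 1\<close>, it exhibits \<open>X\<close> as the line spanned by \<open>s\<close> and another point.
\<close>
lemma contract_join:
  "pluecker s (meet X e) = hodge (pluecker (join X s) e) - pairing e s *s X"
  by (simp add: coordinates algebra_simps)

lemma meet_pluecker: "meet (pluecker u v) a = pairing a v *s u - pairing a u *s v"
  by (simp add: coordinates algebra_simps)

lemma join_pluecker_self: "join (pluecker s w) s = 0"
  by (simp add: coordinates algebra_simps)

lemma pairing_meet: "pairing a (meet X b) = - pairing b (meet X a)"
  by (simp add: coordinates algebra_simps)

lemma pairing_meet_pluecker: "pairing (meet W p) s = (\<Sum>i\<in>UNIV. W $ i * pluecker s p $ i)"
  unfolding UNIV_6_from_0 by (simp add: coordinates algebra_simps)

lemma meet_eq_0_imp: "(\<And>e. meet X e = 0) \<Longrightarrow> X = 0"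
proof -
  assume *: "\<And>e. meet X e = 0"
  show "X = 0"
    using *[of "vec4 1 0 0 0"] *[of "vec4 0 1 0 0"] *[of "vec4 0 0 1 0"] by (simp add: coordinates)
qed

lemma nonzero_imp_pairing_1:
  assumes "s \<noteq> 0"
  obtains e where "pairing e s = 1"
  using nonzero_imp_dual_vector[OF assms] unfolding pairing_sum by blast

lemma pluecker_eq_0_iff:
  fixes s w :: "'k::field ^ 4"
  assumes "s \<noteq> 0"
  shows "pluecker s w = 0 \<longleftrightarrow> w \<in> vec.span {s}"
proof
  assume "pluecker s w = 0"
  obtain e where e: "pairing e s = 1" using nonzero_imp_pairing_1[OF assms] .
  have "w = pairing e w *s s"
    using meet_pluecker[of s w e] e \<open>pluecker s w = 0\<close> by (simp add: meet_simps)
  then show "w \<in> vec.span {s}" unfolding vec.span_singleton by blast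
qed (auto simp: vec.span_singleton pluecker_simps)

section \<open>The two families of annihilators of spinors\<close>

text \<open>
  As sets of bivectors, the lines through the point \<open>s\<close> and the lines in the plane \<open>a\<close>: the two kinds
  of pure spinors and the subspaces that annihilate them. Being linear, these conditions are
  easier to count with than the unions over lines in the definitions of Latin and Greek planes.
\<close>
definition lines_through :: "'k::field ^ 4 \<Rightarrow> ('k ^ 6) set" where
  "lines_through s = {X. join X s = 0}"

definition lines_within :: "'k::field ^ 4 \<Rightarrow> ('k ^ 6) set" where
  "lines_within a = {X. meet X a = 0}"

definition annihilator :: "'k::field ^ 4 \<Rightarrow> ('k ^ 4) set" where
  "annihilator a = {v. pairing a v = 0}"

lemma subspace_lines_through: "vec.subspace (lines_through s)"
  unfolding vec.subspace_def by (simp add: lines_through_def join_simps)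

lemma subspace_lines_within: "vec.subspace (lines_within a)"
  unfolding vec.subspace_def by (simp add: lines_within_def meet_simps)

lemma subspace_annihilator: "vec.subspace (annihilator a)"
  unfolding vec.subspace_def by (simp add: annihilator_def pairing_simps)

text \<open>
  Duality: facts about lines in a plane come from facts about lines through a point.
\<close>
lemma lines_within_eq_hodge: "lines_within a = hodge ` lines_through a"
proof -
  have "X \<in> hodge ` lines_through a" if "meet X a = 0" for X
    using that by (intro image_eqI[of _ _ "hodge X"]) (simp_all add: lines_through_def join_def)
  then show ?thesis
    by (auto simp: lines_within_def lines_through_def join_def)
qed

lemma lines_through_eq_range_pluecker:
  fixes s :: "'k::field ^ 4"
  assumes "s \<noteq> 0"
  shows "lines_through s = range (pluecker s)"
proof
  obtain e where e: "pairing e s = 1" using nonzero_imp_pairing_1[OF assms] .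
  show "lines_through s \<subseteq> range (pluecker s)"
  proof
    fix X assume "X \<in> lines_through s"
    then have "X = pluecker s (- meet X e)"
      using contract_join[of s X e] e
      by (simp add: lines_through_def pluecker_simps hodge_simps)
    then show "X \<in> range (pluecker s)" by blast
  qed
qed (auto simp: lines_through_def join_pluecker_self)

lemma klein_form_eq_0_on_lines_through:
  assumes "X \<in> lines_through s" "s \<noteq> 0"
  shows "klein_form X = 0"
proof -
  from assms obtain w where "X = pluecker s w"
    by (auto simp: lines_through_eq_range_pluecker)
  then show ?thesis by (simp add: klein_form_def pluecker_nth algebra_simps)
qed

lemma klein_form_eq_0_on_lines_within:
  assumes "X \<in> lines_within a" "a \<noteq> 0"
  shows "klein_form X = 0"
  using assms klein_form_eq_0_on_lines_through
  by (auto simp: lines_within_eq_hodge)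

text \<open>
  The vectors collinear with \<open>s\<close> form the kernel of \<open>pluecker s\<close>.
\<close>
lemma card_image_pluecker:
  fixes s :: "'k::{field,finite} ^ 4"
  assumes "s \<noteq> 0" "vec.subspace W" "s \<in> W"
  shows "card W = card (pluecker s ` W) * CARD('k)"
proof -
  have "vec.span {s} \<subseteq> W" using assms by (simp add: vec.span_minimal)
  then have "{w \<in> W. pluecker s w = 0} = vec.span {s}"
    using assms(1) by (auto simp: pluecker_eq_0_iff)
  moreover have "card W = card (pluecker s ` W) * card {w \<in> W. pluecker s w = 0}"
    using assms(2)
    by (intro card_additive_kernel_image) (auto simp: pluecker_simps vec.subspace_add vec.subspace_diff)
  ultimately show ?thesis using assms(1) by (simp add: card_span_singleton)
qed

lemma card_lines_through:
  fixes s :: "'k::{field,finite} ^ 4"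
  assumes "s \<noteq> 0"
  shows "card (lines_through s) = CARD('k) ^ 3"
proof -
  have "CARD('k) ^ 4 = card (lines_through s) * CARD('k)"
    using card_image_pluecker[OF assms vec.subspace_UNIV]
    by (simp add: lines_through_eq_range_pluecker[OF assms])
  then show ?thesis by (simp add: power_Suc2 eval_nat_numeral)
qed

lemma card_lines_within:
  fixes a :: "'k::{field,finite} ^ 4"
  assumes "a \<noteq> 0"
  shows "card (lines_within a) = CARD('k) ^ 3"
proof -
  have "inj (hodge :: 'k ^ 6 \<Rightarrow> 'k ^ 6)" by (metis hodge_hodge injI)
  then show ?thesis
    unfolding lines_within_eq_hodge
    by (simp add: card_image inj_on_subset[of _ UNIV] card_lines_through[OF assms])
qed

lemma card_annihilator:
  fixes a :: "'k::{field,finite} ^ 4"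
  assumes "a \<noteq> 0"
  shows "card (annihilator a) = CARD('k) ^ 3"
proof -
  obtain e where "pairing e a = 1" using nonzero_imp_pairing_1[OF assms] .
  then have e: "pairing a e = 1" by (simp add: pairing_def mult.commute)
  have "c \<in> range (pairing a)" for c
    using e by (intro range_eqI[of _ _ "c *s e"]) (simp add: pairing_simps)
  then have "range (pairing a) = UNIV" by auto
  moreover have "card (UNIV :: ('k ^ 4) set) = card (range (pairing a)) * card {x \<in> UNIV. pairing a x = 0}"
    by (rule card_additive_kernel_image) (auto simp: pairing_simps)
  ultimately show ?thesis
    by (simp add: annihilator_def eval_nat_numeral)
qed

text \<open>
  Two distinct points lie on exactly one line. Contracting \<open>X\<close> by a covector that is 1 at \<open>s\<close> and 0 at
  \<open>p\<close> writes \<open>X\<close> as the product of \<open>s\<close> with a multiple of \<open>p\<close>.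
\<close>
lemma lines_through_Int_lines_through:
  fixes s p :: "'k::field ^ 4"
  assumes "s \<noteq> 0" "p \<notin> vec.span {s}"
  shows "lines_through s \<inter> lines_through p = vec.span {pluecker s p}"
proof
  have "pluecker s p \<noteq> 0" using assms by (simp add: pluecker_eq_0_iff)
  then obtain W where W: "(\<Sum>i\<in>UNIV. W $ i * pluecker s p $ i) = 1"
    by (rule nonzero_imp_dual_vector)
  \<comment> \<open>every contraction of \<open>W\<close> by \<open>p\<close> vanishes at \<open>p\<close>, since \<open>W\<close> is skew\<close>
  define e where "e = meet W p"
  have e: "pairing e s = 1"
    using W pairing_meet_pluecker[of W p s] by (simp add: e_def)
  have ep: "pairing e p = 0"
    by (simp add: e_def coordinates algebra_simps)
  show "lines_through s \<inter> lines_through p \<subseteq> vec.span {pluecker s p}"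
  proof
    fix X assume X: "X \<in> lines_through s \<inter> lines_through p"
    have "p \<noteq> 0" using assms vec.span_zero by metis
    then obtain y where y: "X = pluecker p y"
      using X lines_through_eq_range_pluecker by blast
    have "X = - pluecker s (meet X e)"
      using contract_join[of s X e] e X by (simp add: lines_through_def pluecker_simps hodge_simps)
    also have "meet X e = pairing e y *s p"
      using meet_pluecker[of p y e] ep y by simp
    finally have "X = (- pairing e y) *s pluecker s p"
      by (simp add: pluecker_simps)
    then show "X \<in> vec.span {pluecker s p}" unfolding vec.span_singleton by blast
  qed
  have "pluecker s p \<in> lines_through s \<inter> lines_through p"
    by (simp add: lines_through_def coordinates algebra_simps)
  then show "vec.span {pluecker s p} \<subseteq> lines_through s \<inter> lines_through p"
    by (intro vec.span_minimal vec.subspace_inter subspace_lines_through) simp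
qed

lemma lines_through_Int_lines_within:
  fixes p a :: "'k::field ^ 4"
  assumes "p \<noteq> 0"
  shows "lines_through p \<inter> lines_within a =
    (if pairing a p = 0 then pluecker p ` annihilator a else {0})"
proof (cases "pairing a p = 0")
  case True
  then have "meet (pluecker p w) a = 0 \<longleftrightarrow> pairing a w = 0" for w
    using assms by (simp add: meet_pluecker)
  then show ?thesis
    using True by (auto simp: lines_through_eq_range_pluecker[OF assms] lines_within_def annihilator_def)
next
  case False
  have "X = 0" if "X \<in> lines_through p" "X \<in> lines_within a" for X
    using that contract_join[of p X a] False
    by (simp add: lines_through_def lines_within_def pluecker_simps hodge_simps)
  then show ?thesis
    using False subspace_lines_through[of p] subspace_lines_within[of a] by (auto dest: vec.subspace_0)
qed

lemma card_lines_through_Int_lines_within: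
  fixes p a :: "'k::{field,finite} ^ 4"
  assumes "p \<noteq> 0" "a \<noteq> 0"
  shows "card (lines_through p \<inter> lines_within a) = (if pairing a p = 0 then CARD('k) ^ 2 else 1)"
proof (cases "pairing a p = 0")
  case True
  then have "CARD('k) ^ 3 = card (lines_through p \<inter> lines_within a) * CARD('k)"
    using card_image_pluecker[OF assms(1) subspace_annihilator, of a] card_annihilator[OF assms(2)]
    by (simp add: lines_through_Int_lines_within[OF assms(1)] annihilator_def)
  then show ?thesis using True by (simp add: power3_eq_cube power2_eq_square)
qed (simp add: lines_through_Int_lines_within[OF assms(1)])

lemma card_lines_through_Int_lines_through:
  fixes s p :: "'k::{field,finite} ^ 4"
  assumes "s \<noteq> 0" "p \<notin> vec.span {s}"
  shows "card (lines_through s \<inter> lines_through p) = CARD('k)"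
  using assms by (simp add: lines_through_Int_lines_through card_span_singleton pluecker_eq_0_iff)

section \<open>Every generator lies in one of the two families\<close>

text \<open>
  Start with any nonzero half-spinor and apply the elements \<open>Z\<close> of \<open>G\<close> one after another, moving on to
  \<open>Z\<close> times the current spinor whenever that is nonzero. Since the elements of \<open>G\<close> square to zero
  and anticommute, everything that killed the old spinor also kills the new one, and so does \<open>Z\<close>.
  In the end a nonzero vector or covector is killed by all of \<open>G\<close>. Geometrically: lines that
  meet pairwise all pass through a point or all lie in a plane.
\<close>
lemma totally_singular_annihilates_spinor:
  fixes G :: "('k::{field,finite} ^ 6) set"
  assumes "vec.subspace G" and sing: "\<And>X. X \<in> G \<Longrightarrow> klein_form X = 0"
  shows "(\<exists>s. s \<noteq> 0 \<and> G \<subseteq> lines_through s) \<or> (\<exists>a. a \<noteq> 0 \<and> G \<subseteq> lines_within a)"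
proof -
  have polar: "klein_form (X + Y) = 0" if "X \<in> G" "Y \<in> G" for X Y
    using that assms(1) by (intro sing vec.subspace_add)
  have "finite G" by simp
  then show ?thesis
    using subset_refl[of G]
  proof (induction rule: finite_subset_induct')
    case empty
    have "axis 0 1 \<noteq> (0 :: 'k ^ 4)" by simp
    then show ?case by blast
  next
    case (insert Z A)
    have anti: "join Z (meet X v) = - join X (meet Z v)" if "X \<in> A" for X v
      using clifford_relation[of Z X v] polar[of Z X] sing[of X] sing[of Z] insert.hyps that
      by (auto simp: eq_neg_iff_add_eq_0)
    have anti': "meet Z (join X v) = - meet X (join Z v)" if "X \<in> A" for X v
      using clifford_relation[of "hodge Z" "hodge X" v] polar[of Z X] sing[of X] sing[of Z] insert.hyps that
      by (auto simp: join_def eq_neg_iff_add_eq_0 simp flip: hodge_simps(1))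
    have sq: "join Z (meet Z v) = 0" for v
      using clifford_square[of Z v] sing[of Z] insert.hyps by simp
    have sq': "meet Z (join Z v) = 0" for v
      using clifford_square[of "hodge Z" v] sing[of Z] insert.hyps by (simp add: join_def)
    from insert.IH show ?case
    proof
      assume "\<exists>s. s \<noteq> 0 \<and> A \<subseteq> lines_through s"
      then obtain s where s: "s \<noteq> 0" "\<And>X. X \<in> A \<Longrightarrow> join X s = 0"
        by (auto simp: lines_through_def)
      show ?thesis
      proof (cases "join Z s = 0")
        case True
        then show ?thesis using s by (auto simp: lines_through_def)
      next
        case False
        have "meet X (join Z s) = 0" if "X \<in> insert Z A" for X
          using that s(2) sq' anti'[of X s] by (auto simp: meet_simps)
        then have "insert Z A \<subseteq> lines_within (join Z s)" by (auto simp: lines_within_def)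
        then show ?thesis using False by blast
      qed
    next
      assume "\<exists>a. a \<noteq> 0 \<and> A \<subseteq> lines_within a"
      then obtain a where a: "a \<noteq> 0" "\<And>X. X \<in> A \<Longrightarrow> meet X a = 0"
        by (auto simp: lines_within_def)
      show ?thesis
      proof (cases "meet Z a = 0")
        case True
        then show ?thesis using a by (auto simp: lines_within_def)
      next
        case False
        have "join X (meet Z a) = 0" if "X \<in> insert Z A" for X
          using that a(2) sq anti[of X a] by (auto simp: join_simps)
        then have "insert Z A \<subseteq> lines_through (meet Z a)" by (auto simp: lines_through_def)
        then show ?thesis using False by blast
      qed
    qed
  qed
qed

lemma klein_generators_iff:
  fixes G :: "('k::{field,finite} ^ 6) set"
  shows "G \<in> klein_generators \<longleftrightarrow>
    (\<exists>s. s \<noteq> 0 \<and> G = lines_through s) \<or> (\<exists>a. a \<noteq> 0 \<and> G = lines_within a)"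
proof
  assume "G \<in> klein_generators"
  then have G: "vec.subspace G" "card G = CARD('k) ^ 3" "\<And>X. X \<in> G \<Longrightarrow> klein_form X = 0"
    by (auto simp: klein_generators_def in_proj_subspaces_iff)
  then show "(\<exists>s. s \<noteq> 0 \<and> G = lines_through s) \<or> (\<exists>a. a \<noteq> 0 \<and> G = lines_within a)"
    using totally_singular_annihilates_spinor[OF G(1,3)]
    by (metis vec_subspace_eqI card_lines_through card_lines_within)
next
  assume "(\<exists>s. s \<noteq> 0 \<and> G = lines_through s) \<or> (\<exists>a. a \<noteq> 0 \<and> G = lines_within a)"
  then show "G \<in> klein_generators"
    by (auto simp: klein_generators_def in_proj_subspaces_iff subspace_lines_through subspace_lines_within
        card_lines_through card_lines_within
        dest: klein_form_eq_0_on_lines_through klein_form_eq_0_on_lines_within)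
qed

section \<open>Latin and Greek planes\<close>

lemma ex_outside_span_singleton:
  fixes W :: "('k::{field,finite} ^ 'n) set"
  assumes "card W > CARD('k)"
  obtains w where "w \<in> W" "w \<notin> vec.span {s}"
proof -
  have "card (vec.span {s}) \<le> CARD('k)"
    using card_span_singleton[of s] CARD_field_gt_1[where 'k='k] by (cases "s = 0") auto
  then have "\<not> W \<subseteq> vec.span {s}"
    using assms card_mono[of "vec.span {s}" W] by auto
  then show ?thesis using that by blast
qed

lemma span_pair_in_proj_lines:
  fixes s w :: "'k::{field,finite} ^ 'n"
  assumes "s \<noteq> 0" "w \<notin> vec.span {s}"
  shows "vec.span {s, w} \<in> proj_lines"
proof -
  have "vec.independent {s}" using assms(1) by simp
  then have "vec.independent {w, s}"
    using assms(2) by (rule vec.independent_insertI[rotated])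
  moreover have "w \<noteq> s" using assms(2) vec.span_base by blast
  ultimately have "vec.dim (vec.span {s, w}) = 2"
    by (subst vec.dim_span_eq_card_independent) (auto simp: insert_commute)
  then show ?thesis by (simp add: proj_subspaces_def)
qed

lemma proj_line_eq_span_pair:
  fixes L :: "('k::{field,finite} ^ 'n) set"
  assumes "L \<in> proj_lines" "s \<in> L" "s \<noteq> 0"
  obtains w where "w \<notin> vec.span {s}" "L = vec.span {s, w}"
proof -
  have L: "vec.subspace L" "card L = CARD('k) ^ 2" using assms(1) by (auto simp: in_proj_subspaces_iff)
  have "card L > CARD('k)" using L(2) CARD_field_gt_1[where 'k='k] by (simp add: power2_eq_square)
  then obtain w where w: "w \<in> L" "w \<notin> vec.span {s}" by (rule ex_outside_span_singleton)
  have "vec.span {s, w} = L"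
  proof (rule vec_subspace_eqI)
    show "vec.span {s, w} \<subseteq> L" using w assms(2) L(1) by (simp add: vec.span_minimal)
    show "card (vec.span {s, w}) = card L"
      using span_pair_in_proj_lines[OF assms(3) w(2)] L(2) by (simp add: in_proj_subspaces_iff)
  qed
  then show ?thesis using that w by blast
qed

text \<open>
  Every line through \<open>s\<close> has the form \<open>vec.span {s, w}\<close>, and all Pluecker vectors of pairs in this
  span are multiples of \<open>pluecker s w\<close>.
\<close>
lemma latin_plane_eq_lines_through:
  fixes s :: "'k::{field,finite} ^ 4"
  assumes "s \<noteq> 0"
  shows "latin_plane (vec.span {s}) = lines_through s"
proof
  show "latin_plane (vec.span {s}) \<subseteq> lines_through s"
  proof -
    have "klein_corr L \<subseteq> lines_through s" if L: "L \<in> proj_lines" "vec.span {s} \<subseteq> L" for L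
      unfolding klein_corr_def
    proof (rule vec.span_minimal)
      have "s \<in> L" using L(2) vec.span_base by blast
      then obtain w where w: "L = vec.span {s, w}"
        using proj_line_eq_span_pair[OF L(1) _ assms] by metis
      have "\<exists>b c. u = b *s s + c *s w" if "u \<in> L" for u
      proof -
        from that obtain b where "u - b *s s \<in> vec.span {w}"
          unfolding w vec.span_insert[of s] by blast
        then obtain c where "u - b *s s = c *s w" unfolding vec.span_singleton by blast
        then have "u = b *s s + c *s w" by (metis add.commute diff_add_cancel)
        then show ?thesis by blast
      qed
      then show "{pluecker u v |u v. u \<in> L \<and> v \<in> L} \<subseteq> lines_through s"
      proof (clarify, goal_cases)
        case (1 _ u v)
        then obtain b c b' c' where "u = b *s s + c *s w" "v = b' *s s + c' *s w" by metis
        then have "pluecker u v = (b * c' - c * b') *s pluecker s w"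
          by (simp add: vec6_eq_iff pluecker_nth algebra_simps)
        then show ?case
          by (simp only: lines_through_def mem_Collect_eq join_simps join_pluecker_self vec.scale_zero_right)
      qed
    qed (rule subspace_lines_through)
    then show ?thesis by (auto simp: latin_plane_def)
  qed
  have line: "X \<in> latin_plane (vec.span {s})" if "X \<in> klein_corr (vec.span {s, w})" "w \<notin> vec.span {s}" for X w
    using that span_pair_in_proj_lines[OF assms] vec.span_mono[of "{s}" "{s, w}"]
    by (auto simp: latin_plane_def)
  show "lines_through s \<subseteq> latin_plane (vec.span {s})"
  proof
    fix X assume "X \<in> lines_through s"
    then obtain w where X: "X = pluecker s w" using lines_through_eq_range_pluecker[OF assms] by auto
    show "X \<in> latin_plane (vec.span {s})"
    proof (cases "w \<in> vec.span {s}")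
      case True
      then have "X = 0" using X assms by (simp add: pluecker_eq_0_iff)
      have "card (UNIV :: ('k ^ 4) set) > CARD('k)"
        using CARD_field_gt_1[where 'k='k] power_strict_increasing[of 1 4 "CARD('k)"] by simp
      then obtain w' where "w' \<notin> vec.span {s}" by (rule ex_outside_span_singleton)
      then show ?thesis
        using line[of X w'] \<open>X = 0\<close> by (simp add: klein_corr_def vec.span_zero)
    next
      case False
      have "X \<in> klein_corr (vec.span {s, w})"
        unfolding klein_corr_def X by (rule vec.span_base) (auto intro: vec.span_base)
      then show ?thesis using line False by blast
    qed
  qed
qed

text \<open>
  A nonzero \<open>X\<close> in \<open>lines_within a\<close> is singular, so it kills each \<open>u = meet X e\<close>, and where \<open>u\<close> is
  nonzero it is therefore a product \<open>pluecker u w\<close>; contraction by \<open>a\<close> then shows that \<open>u\<close> and \<open>w\<close> lie in the plane.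
\<close>
lemma greek_plane_eq_lines_within:
  fixes a :: "'k::{field,finite} ^ 4"
  assumes "a \<noteq> 0"
  shows "greek_plane (annihilator a) = lines_within a"
proof
  have "klein_corr L \<subseteq> lines_within a" if "L \<subseteq> annihilator a" for L
    unfolding klein_corr_def
    by (rule vec.span_minimal[OF _ subspace_lines_within])
      (use that in \<open>auto simp: lines_within_def meet_pluecker annihilator_def subset_iff\<close>)
  then show "greek_plane (annihilator a) \<subseteq> lines_within a"
    by (auto simp: greek_plane_def)
  have line: "X \<in> greek_plane (annihilator a)"
    if "X \<in> klein_corr (vec.span {s, w})" "s \<noteq> 0" "w \<notin> vec.span {s}"
      "s \<in> annihilator a" "w \<in> annihilator a" for X s w
    using that span_pair_in_proj_lines[of s w] subspace_annihilator[of a]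
      vec.span_minimal[of "{s, w}" "annihilator a"]
    by (auto simp: greek_plane_def)
  show "lines_within a \<subseteq> greek_plane (annihilator a)"
  proof
    fix X assume X: "X \<in> lines_within a"
    show "X \<in> greek_plane (annihilator a)"
    proof (cases "X = 0")
      case True
      \<comment> \<open>the zero vector lies on every line, so any line in the plane will do\<close>
      have big: "card (annihilator a) > CARD('k)"
        using CARD_field_gt_1[where 'k='k] power_strict_increasing[of 1 3 "CARD('k)"]
        by (simp add: card_annihilator[OF assms])
      obtain s where s: "s \<in> annihilator a" "s \<notin> vec.span {0}"
        using ex_outside_span_singleton[OF big] by blast
      obtain w where w: "w \<in> annihilator a" "w \<notin> vec.span {s}"
        using ex_outside_span_singleton[OF big] by blast
      show ?thesis
        using line[of X s w] s w True by (auto simp: klein_corr_def vec.span_zero)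
    next
      case False
      then obtain e where e: "meet X e \<noteq> 0" using meet_eq_0_imp by blast
      define u where "u = meet X e"
      have "u \<noteq> 0" using e by (simp add: u_def)
      have "join X u = 0"
        using clifford_square[of X e] klein_form_eq_0_on_lines_within[OF X assms] by (simp add: u_def)
      then obtain w where w: "X = pluecker u w"
        using lines_through_eq_range_pluecker[OF \<open>u \<noteq> 0\<close>] by (auto simp: lines_through_def)
      have Xa: "meet X a = 0" using X by (simp add: lines_within_def)
      have au: "pairing a u = 0" using pairing_meet[of a X e] Xa by (simp add: u_def pairing_simps)
      then have "pairing a w = 0"
        using meet_pluecker[of u w a] Xa w \<open>u \<noteq> 0\<close> by simp
      moreover have "w \<notin> vec.span {u}"
        using False w \<open>u \<noteq> 0\<close> pluecker_eq_0_iff by blast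
      moreover have "X \<in> klein_corr (vec.span {u, w})"
        unfolding klein_corr_def w by (rule vec.span_base) (auto intro: vec.span_base)
      ultimately show ?thesis
        using line \<open>u \<noteq> 0\<close> au by (simp add: annihilator_def)
    qed
  qed
qed

text \<open>
  Evaluation of covectors on three spanning vectors of \<open>E\<close> maps a set of \<open>CARD('k) ^ 4\<close> elements into
  one of \<open>CARD('k) ^ 3\<close>, so two different covectors agree on \<open>E\<close>; their difference defines \<open>E\<close>.
\<close>
lemma proj_planes_iff:
  fixes E :: "('k::{field,finite} ^ 4) set"
  shows "E \<in> proj_planes \<longleftrightarrow> (\<exists>a. a \<noteq> 0 \<and> E = annihilator a)"
proof
  assume "E \<in> proj_planes"
  then have E: "vec.subspace E" "vec.dim E = 3" "card E = CARD('k) ^ 3"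
    by (auto simp: in_proj_subspaces_iff proj_subspaces_def card_vec_subspace)
  obtain B where B: "B \<subseteq> E" "E \<subseteq> vec.span B" "card B = 3"
    using vec.basis_exists[of E] E(2) by metis
  then obtain x y z where xyz: "B = {x, y, z}" by (metis card_3_iff)
  define h where "h a = (pairing a x, pairing a y, pairing a z)" for a
  have "\<not> inj h"
  proof
    assume "inj h"
    then have "CARD('k ^ 4) \<le> CARD('k \<times> 'k \<times> 'k)"
      by (intro card_inj_on_le[of h]) auto
    then have "CARD('k) ^ 4 \<le> CARD('k) ^ 3" by (simp add: eval_nat_numeral card_cartesian_product flip: UNIV_Times_UNIV)
    then show False using CARD_field_gt_1[where 'k='k] by (simp add: power_increasing_iff)
  qed
  then obtain b c where bc: "b \<noteq> c" "h b = h c" by (auto simp: inj_def)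
  define a where "a = b - c"
  have "a \<noteq> 0" using bc by (simp add: a_def)
  have "pairing a v = pairing b v - pairing c v" for v
    by (simp add: a_def pairing_def algebra_simps)
  then have "B \<subseteq> annihilator a"
    using bc(2) by (simp add: xyz annihilator_def h_def)
  then have "E \<subseteq> annihilator a"
    using B(2) vec.span_minimal[OF _ subspace_annihilator] by blast
  then have "E = annihilator a"
    by (rule vec_subspace_eqI) (simp add: E(3) card_annihilator[OF \<open>a \<noteq> 0\<close>])
  then show "\<exists>a. a \<noteq> 0 \<and> E = annihilator a" using \<open>a \<noteq> 0\<close> by blast
qed (auto simp: in_proj_subspaces_iff subspace_annihilator card_annihilator)

lemma lines_through_eq_imp:
  fixes s p :: "'k::{field,finite} ^ 4"
  assumes "s \<noteq> 0" "p \<noteq> 0" "lines_through s = lines_through p"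
  shows "vec.span {s} = vec.span {p}"
proof (rule ccontr)
  assume "vec.span {s} \<noteq> vec.span {p}"
  then have "p \<notin> vec.span {s}" using assms span_singleton_eq_iff by metis
  then have "CARD('k) ^ 3 = CARD('k) ^ 1"
    using card_lines_through_Int_lines_through[OF assms(1) \<open>p \<notin> vec.span {s}\<close>]
      card_lines_through[OF assms(2)] assms(3) by simp
  then show False using CARD_field_gt_1[where 'k='k] by (subst (asm) power_inject_exp) auto
qed

lemma lines_through_neq_lines_within:
  fixes p a :: "'k::{field,finite} ^ 4"
  assumes "p \<noteq> 0" "a \<noteq> 0"
  shows "lines_through p \<noteq> lines_within a"
proof
  assume "lines_through p = lines_within a"
  then have "CARD('k) ^ 3 = (if pairing a p = 0 then CARD('k) ^ 2 else CARD('k) ^ 0)"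
    using card_lines_through_Int_lines_within[OF assms] card_lines_within[OF assms(2)] by simp
  then show False using CARD_field_gt_1[where 'k='k]
    by (auto split: if_splits simp del: power_0)
qed

lemma lines_within_eq_imp:
  fixes a b :: "'k::{field,finite} ^ 4"
  assumes "a \<noteq> 0" "b \<noteq> 0" "lines_within a = lines_within b"
  shows "annihilator a = annihilator b"
proof -
  have "(pairing a p = 0) = (pairing b p = 0)" for p
  proof (cases "p = 0")
    case False
    have "CARD('k) ^ 2 \<noteq> 1" using CARD_field_gt_1[where 'k='k] by simp
    then show ?thesis
      using card_lines_through_Int_lines_within[OF False assms(1)]
        card_lines_through_Int_lines_within[OF False assms(2)] assms(3) by metis
  qed (simp add: pairing_simps)
  then show ?thesis by (auto simp: annihilator_def)
qed

section \<open>Two-intersection sets of points give Cameron-Liebler sets\<close>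

lemma sum_card_swap:
  assumes "finite A" "finite B"
  shows "(\<Sum>x\<in>A. card {y \<in> B. R x y}) = (\<Sum>y\<in>B. card {x \<in> A. R x y})"
proof -
  have "(\<Sum>x\<in>A. card {y \<in> B. R x y}) = (\<Sum>x\<in>A. \<Sum>y\<in>B. of_bool (R x y))"
    using assms(2) by (intro sum.cong) (simp_all add: sum_of_bool_eq Int_def)
  also have "\<dots> = (\<Sum>y\<in>B. \<Sum>x\<in>A. of_bool (R x y))" by (rule sum.swap)
  also have "\<dots> = (\<Sum>y\<in>B. card {x \<in> A. R x y})"
    using assms(1) by (intro sum.cong) (simp_all add: sum_of_bool_eq Int_def)
  finally show ?thesis .
qed

lemma annihilator_eq_iff:
  fixes a b :: "'k::{field,finite} ^ 4"
  assumes "a \<noteq> 0" "b \<noteq> 0"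
  shows "annihilator a = annihilator b \<longleftrightarrow> vec.span {a} = vec.span {b}"
proof
  assume "annihilator a = annihilator b"
  then have "lines_within a = lines_within b"
    using greek_plane_eq_lines_within assms by metis
  then have "hodge ` hodge ` lines_through a = hodge ` hodge ` lines_through b"
    by (simp add: lines_within_eq_hodge)
  then have "lines_through a = lines_through b" by (simp add: image_comp comp_def)
  then show "vec.span {a} = vec.span {b}" by (rule lines_through_eq_imp[OF assms])
next
  assume "vec.span {a} = vec.span {b}"
  then have "lines_through a = lines_through b"
    using latin_plane_eq_lines_through assms by metis
  then show "annihilator a = annihilator b"
    by (intro lines_within_eq_imp assms) (simp add: lines_within_eq_hodge)
qed

lemma span_singleton_subset_annihilator_iff:
  "vec.span {s} \<subseteq> annihilator a \<longleftrightarrow> pairing a s = 0"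
  using vec.span_minimal[OF _ subspace_annihilator, of "{s}" a] vec.span_base[of s "{s}"]
  by (auto simp: annihilator_def)

text \<open>
  The constants are tied together by the weights below: a chosen point and a chosen plane must produce
  the same surplus of incidences, which fixes the difference \<open>CARD('k)\<close> of the intersection numbers, and
  a point outside \<open>P0\<close> and a plane with \<open>m\<close> points must produce equally many, which fixes \<open>card P0\<close>.
\<close>
context
  fixes P0 :: "('k::{field,finite} ^ 4) set set" and m :: nat
    and P2 :: "('k ^ 4) set set" and \<L> :: "('k ^ 6) set set"
  assumes points: "P0 \<subseteq> proj_points"
    and card_P0: "card P0 = m * (CARD('k) + 1)"
    and two_intersections: "\<And>E. E \<in> proj_planes \<Longrightarrow>
      card {P \<in> P0. P \<subseteq> E} = m \<or> card {P \<in> P0. P \<subseteq> E} = m + CARD('k)"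
  defines "P2 \<equiv> {E \<in> proj_planes. card {P \<in> P0. P \<subseteq> E} = m + CARD('k)}"
    and "\<L> \<equiv> latin_plane ` P0 \<union> greek_plane ` P2"
begin

lemma lines_through_in_L_iff:
  assumes "s \<noteq> 0"
  shows "lines_through s \<in> \<L> \<longleftrightarrow> vec.span {s} \<in> P0"
proof
  assume "lines_through s \<in> \<L>"
  then consider P where "P \<in> P0" "lines_through s = latin_plane P"
    | E where "E \<in> P2" "lines_through s = greek_plane E"
    by (auto simp: \<L>_def)
  then show "vec.span {s} \<in> P0"
  proof cases
    case 1
    moreover obtain p where p: "p \<noteq> 0" "P = vec.span {p}"
      using 1 points unfolding proj_points_iff by (metis subsetD proj_points_iff)
    ultimately show ?thesis
      using lines_through_eq_imp[OF assms p(1)] by (simp add: latin_plane_eq_lines_through)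
  next
    case 2
    then obtain a where "a \<noteq> 0" "E = annihilator a"
      by (auto simp: P2_def proj_planes_iff)
    then show ?thesis
      using 2 lines_through_neq_lines_within[OF assms] by (simp add: greek_plane_eq_lines_within)
  qed
next
  assume "vec.span {s} \<in> P0"
  then show "lines_through s \<in> \<L>"
    unfolding \<L>_def latin_plane_eq_lines_through[OF assms, symmetric] by blast
qed

lemma lines_within_in_L_iff:
  assumes "a \<noteq> 0"
  shows "lines_within a \<in> \<L> \<longleftrightarrow> annihilator a \<in> P2"
proof
  assume "lines_within a \<in> \<L>"
  then consider P where "P \<in> P0" "lines_within a = latin_plane P"
    | E where "E \<in> P2" "lines_within a = greek_plane E"
    by (auto simp: \<L>_def)
  then show "annihilator a \<in> P2"
  proof cases
    case 1
    then obtain p where p: "p \<noteq> 0" "P = vec.span {p}"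
      using points by (metis subsetD proj_points_iff)
    then show ?thesis
      using 1 lines_through_neq_lines_within[OF p(1) assms] by (simp add: latin_plane_eq_lines_through)
  next
    case 2
    then obtain b where "b \<noteq> 0" "E = annihilator b"
      by (auto simp: P2_def proj_planes_iff)
    then show ?thesis
      using 2 lines_within_eq_imp[OF assms] by (simp add: greek_plane_eq_lines_within)
  qed
next
  assume "annihilator a \<in> P2"
  then show "lines_within a \<in> \<L>"
    unfolding \<L>_def greek_plane_eq_lines_within[OF assms, symmetric] by blast
qed

lemma L_subset_generators: "\<L> \<subseteq> klein_generators"
proof -
  have "latin_plane P \<in> klein_generators" if "P \<in> P0" for P
    using that points latin_plane_eq_lines_through
    by (metis subsetD proj_points_iff klein_generators_iff)
  moreover have "greek_plane E \<in> klein_generators" if "E \<in> P2" for E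
    using that greek_plane_eq_lines_within unfolding P2_def
    by (metis (lifting) mem_Collect_eq proj_planes_iff klein_generators_iff)
  ultimately show ?thesis by (auto simp: \<L>_def)
qed

text \<open>
  Double counting of the pairs of a nonzero covector and a point of \<open>P0\<close> in its plane, where
  each plane is counted \<open>CARD('k) - 1\<close> times: every point lies on equally many planes, so the two
  intersection numbers determine how often each of them occurs.
\<close>
lemma card_P2: "card P2 = m * (CARD('k) + 1)"
proof -
  define Q where "Q = CARD('k)"
  have "Q > 1" using CARD_field_gt_1[where 'k='k] by (simp add: Q_def)
  define A where "A = (UNIV :: ('k ^ 4) set) - {0}"
  define A2 where "A2 = {a \<in> A. annihilator a \<in> P2}"
  have card_A: "card A = Q ^ 4 - 1" by (simp add: A_def Q_def card_Diff_singleton)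
  have "annihilator ` A2 = P2"
    by (auto simp: A2_def A_def P2_def proj_planes_iff)
  moreover have "card A2 = card (annihilator ` A2) * (Q - 1)"
  proof (rule card_eq_fibre_card_times_image)
    fix E assume "E \<in> annihilator ` A2"
    then obtain b where b: "b \<in> A2" "E = annihilator b" by blast
    then have "b \<noteq> 0" by (simp add: A2_def A_def)
    have "{a \<in> A2. annihilator a = E} = {a \<in> A. annihilator a = annihilator b}"
      using b by (auto simp: A2_def)
    also have "\<dots> = vec.span {b} - {0}"
    proof -
      have "annihilator a = annihilator b \<longleftrightarrow> a \<in> vec.span {b}" if "a \<noteq> 0" for a
        using that \<open>b \<noteq> 0\<close> annihilator_eq_iff span_singleton_eq_iff by metis
      then show ?thesis unfolding A_def by blast
    qed
    finally show "card {a \<in> A2. annihilator a = E} = Q - 1"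
      using \<open>b \<noteq> 0\<close> by (simp add: card_Diff_singleton vec.span_zero card_span_singleton Q_def)
  qed simp
  ultimately have card_A2: "card A2 = card P2 * (Q - 1)" by simp
  have "(\<Sum>a\<in>A. card {P \<in> P0. P \<subseteq> annihilator a}) = (\<Sum>P\<in>P0. card {a \<in> A. P \<subseteq> annihilator a})"
    by (rule sum_card_swap) simp_all
  also have "\<dots> = (\<Sum>P\<in>P0. Q ^ 3 - 1)"
  proof (rule sum.cong)
    fix P assume "P \<in> P0"
    then obtain s where s: "s \<noteq> 0" "P = vec.span {s}" using points by (metis subsetD proj_points_iff)
    have "{a \<in> A. P \<subseteq> annihilator a} = annihilator s - {0}"
      unfolding s(2) span_singleton_subset_annihilator_iff
      by (auto simp: A_def annihilator_def pairing_def mult.commute)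
    moreover have "0 \<in> annihilator s" using subspace_annihilator vec.subspace_0 by blast
    ultimately show "card {a \<in> A. P \<subseteq> annihilator a} = Q ^ 3 - 1"
      using s(1) by (simp add: card_Diff_singleton card_annihilator Q_def)
  qed simp
  also have "\<dots> = m * (Q + 1) * (Q ^ 3 - 1)" by (simp add: card_P0 Q_def)
  finally have 1: "(\<Sum>a\<in>A. card {P \<in> P0. P \<subseteq> annihilator a}) = m * (Q + 1) * (Q ^ 3 - 1)" .
  have "(\<Sum>a\<in>A. card {P \<in> P0. P \<subseteq> annihilator a}) = (\<Sum>a\<in>A. m + (if a \<in> A2 then Q else 0))"
  proof (rule sum.cong)
    fix a assume "a \<in> A"
    then have "annihilator a \<in> proj_planes" by (auto simp: A_def proj_planes_iff)
    then show "card {P \<in> P0. P \<subseteq> annihilator a} = m + (if a \<in> A2 then Q else 0)"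
      using two_intersections[of "annihilator a"] \<open>a \<in> A\<close> by (auto simp: A2_def P2_def Q_def)
  qed simp
  also have "\<dots> = m * (Q ^ 4 - 1) + card A2 * Q"
  proof -
    have "A \<inter> A2 = A2" by (auto simp: A2_def)
    then show ?thesis by (simp add: sum.distrib card_A flip: sum.inter_restrict)
  qed
  finally have eq: "m * (Q ^ 4 - 1) + card P2 * (Q - 1) * Q = m * (Q + 1) * (Q ^ 3 - 1)"
    unfolding 1 card_A2 by simp
  have "real m * (real Q ^ 4 - 1) + real (card P2) * (real Q - 1) * real Q =
      real m * (real Q + 1) * (real Q ^ 3 - 1)"
  proof -
    have diff: "real (Q ^ k - 1) = real Q ^ k - 1" for k
      using \<open>Q > 1\<close> by (simp add: of_nat_diff)
    show ?thesis
      using arg_cong[OF eq, of real] unfolding of_nat_add of_nat_mult diff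
      using diff[of 1] by simp
  qed
  then have "(real Q * (real Q - 1)) * real (card P2) = (real Q * (real Q - 1)) * (real m * (real Q + 1))"
    by (simp add: algebra_simps eval_nat_numeral)
  then have "real (card P2) = real m * (real Q + 1)" using \<open>Q > 1\<close> by simp
  then have "real (card P2) = real (m * (Q + 1))" by (simp add: distrib_left)
  then show ?thesis unfolding Q_def of_nat_eq_iff .
qed

lemma has_parameter_L: "has_parameter \<L> (real m)"
proof -
  have "inj_on latin_plane P0"
  proof (rule inj_onI)
    fix P P' assume "P \<in> P0" "P' \<in> P0" and eq: "latin_plane P = latin_plane P'"
    then obtain s s' where "s \<noteq> 0" "P = vec.span {s}" "s' \<noteq> 0" "P' = vec.span {s'}"
      using points by (metis subsetD proj_points_iff)
    then show "P = P'" using eq lines_through_eq_imp by (simp add: latin_plane_eq_lines_through)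
  qed
  moreover have "inj_on greek_plane P2"
  proof (rule inj_onI)
    fix E E' assume "E \<in> P2" "E' \<in> P2" and eq: "greek_plane E = greek_plane E'"
    then obtain a a' where "a \<noteq> 0" "E = annihilator a" "a' \<noteq> 0" "E' = annihilator a'"
      by (auto simp: P2_def proj_planes_iff)
    then show "E = E'" using eq lines_within_eq_imp by (simp add: greek_plane_eq_lines_within)
  qed
  moreover have "latin_plane ` P0 \<inter> greek_plane ` P2 = {}"
  proof -
    have "latin_plane P \<noteq> greek_plane E" if PE: "P \<in> P0" "E \<in> P2" for P E
    proof -
      obtain s where "s \<noteq> 0" "P = vec.span {s}" using PE(1) points by (metis subsetD proj_points_iff)
      moreover obtain a where "a \<noteq> 0" "E = annihilator a" using PE(2) by (auto simp: P2_def proj_planes_iff)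
      ultimately show ?thesis
        using lines_through_neq_lines_within
        by (simp add: latin_plane_eq_lines_through greek_plane_eq_lines_within)
    qed
    then show ?thesis by blast
  qed
  ultimately have "card \<L> = card P0 + card P2"
    unfolding \<L>_def by (subst card_Un_disjoint) (simp_all add: card_image)
  then show ?thesis
    by (simp add: has_parameter_def card_P0 card_P2 algebra_simps)
qed

text \<open>
  The weight of a line is an affine function of the number of points of \<open>P0\<close> on it. Among the
  lines through a point \<open>s\<close>, each point of \<open>P0\<close> other than \<open>s\<close> lies on one, and \<open>s\<close> itself lies on all
  \<open>Q\<^sup>2 + Q + 1\<close>; among the lines of a plane, each point of \<open>P0\<close> in the plane lies on \<open>Q + 1\<close>. Hence the
  total number of incidences is \<open>card P0\<close>, increased by \<open>Q\<^sup>2 + Q\<close> if \<open>s\<close> is in \<open>P0\<close>, in the first case and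
  \<open>m * (Q + 1) = card P0\<close>, increased by \<open>Q * (Q + 1)\<close> for planes in \<open>P2\<close>, in the second. The
  common surplus is normalised to 1 by \<open>\<alpha>\<close>, and the constant \<open>\<gamma>\<close>, spread over the
  \<open>Q\<^sup>2 + Q + 1\<close> lines of a generator, cancels the contribution of \<open>card P0\<close>.
\<close>
lemma cameron_liebler_L: "cameron_liebler \<L>"
proof -
  define Q where "Q = real CARD('k)"
  have Q: "Q > 1" using CARD_field_gt_1[where 'k='k] by (simp add: Q_def)
  then have Q': "Q\<^sup>2 + Q + 1 > 0" by (simp add: add_pos_pos)
  define \<alpha> where "\<alpha> = 1 / (Q * (Q + 1))"
  define \<gamma> where "\<gamma> = - \<alpha> * real (card P0) / (Q\<^sup>2 + Q + 1)"
  define f where "f P = \<alpha> * real (card {p \<in> P0. P \<subseteq> latin_plane p}) + \<gamma>" for P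
  define count :: "('k ^ 6) set \<Rightarrow> real" where "count W = real (card {P \<in> proj_points. P \<subseteq> W})" for W
  have count: "count W = (real (card W) - 1) / (Q - 1)" if "vec.subspace W" for W
    unfolding count_def Q_def by (rule card_points_in_subspace[OF that])
  have geometric: "(Q ^ 3 - 1) / (Q - 1) = Q\<^sup>2 + Q + 1" "(Q\<^sup>2 - 1) / (Q - 1) = Q + 1"
    using Q by (simp_all add: divide_simps) (simp_all add: algebra_simps eval_nat_numeral)
  have "indicator \<L> G = (\<Sum>P\<in>klein_points. incidence P G * f P)" if G: "G \<in> klein_generators" for G
  proof -
    have count_G: "count G = Q\<^sup>2 + Q + 1"
      using G by (auto simp: klein_generators_def in_proj_subspaces_iff count Q_def[symmetric] geometric)
    have "{P \<in> proj_points. P \<subseteq> G} = {P \<in> klein_points. P \<subseteq> G}"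
      using G by (auto simp: klein_generators_def klein_points_def)
    then have "(\<Sum>P\<in>klein_points. incidence P G * f P) = (\<Sum>P | P \<in> proj_points \<and> P \<subseteq> G. f P)"
      by (simp add: incidence_def if_distrib[of "\<lambda>x. x * _"] sum.If_cases Int_def cong: if_cong)
    also have "\<dots> = \<alpha> * real (\<Sum>P | P \<in> proj_points \<and> P \<subseteq> G. card {p \<in> P0. P \<subseteq> latin_plane p}) + \<gamma> * count G"
      by (simp add: f_def sum.distrib count_def sum_distrib_left mult.commute)
    also have "(\<Sum>P | P \<in> proj_points \<and> P \<subseteq> G. card {p \<in> P0. P \<subseteq> latin_plane p}) =
        (\<Sum>p\<in>P0. card {P \<in> proj_points. P \<subseteq> G \<inter> latin_plane p})"
      by (subst sum_card_swap) (simp_all add: conj_assoc)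
    also have "\<gamma> * count G = - \<alpha> * real (card P0)"
      using Q' by (simp add: \<gamma>_def count_G)
    finally have sum_eq: "(\<Sum>P\<in>klein_points. incidence P G * f P) =
        \<alpha> * ((\<Sum>p\<in>P0. count (G \<inter> latin_plane p)) - real (card P0))"
      by (simp add: count_def algebra_simps)
    from G consider s where "s \<noteq> 0" "G = lines_through s" | a where "a \<noteq> 0" "G = lines_within a"
      by (auto simp: klein_generators_iff)
    then show ?thesis
    proof cases
      case 1
      have "count (G \<inter> latin_plane p) = 1 + (if p = vec.span {s} then Q\<^sup>2 + Q else 0)" if p: "p \<in> P0" for p
      proof (cases "p = vec.span {s}")
        case True
        then show ?thesis using 1 count_G by (simp add: latin_plane_eq_lines_through)
      next
        case False
        obtain x where x: "x \<noteq> 0" "p = vec.span {x}" using p points by (metis subsetD proj_points_iff)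
        then have "x \<notin> vec.span {s}" using False 1(1) span_singleton_eq_iff by metis
        then have "card (G \<inter> latin_plane p) = CARD('k)"
          using x 1 by (simp add: latin_plane_eq_lines_through card_lines_through_Int_lines_through)
        moreover have "vec.subspace (G \<inter> latin_plane p)"
          using x 1 by (simp add: latin_plane_eq_lines_through subspace_lines_through vec.subspace_inter)
        ultimately show ?thesis using False Q by (simp add: count flip: Q_def)
      qed
      then have "(\<Sum>p\<in>P0. count (G \<inter> latin_plane p)) =
          real (card P0) + (if vec.span {s} \<in> P0 then Q\<^sup>2 + Q else 0)"
        by (simp add: sum.distrib)
      moreover have "\<alpha> * (Q\<^sup>2 + Q) = 1"
      proof -
        have "Q\<^sup>2 + Q = Q * (Q + 1)" by (simp add: power2_eq_square algebra_simps)
        moreover have "Q * (Q + 1) \<noteq> 0" using Q by simp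
        ultimately show ?thesis by (simp add: \<alpha>_def)
      qed
      ultimately show ?thesis
        unfolding sum_eq using 1 by (simp add: indicator_def lines_through_in_L_iff)
    next
      case 2
      have "count (G \<inter> latin_plane p) = (if p \<subseteq> annihilator a then Q + 1 else 0)" if p: "p \<in> P0" for p
      proof -
        obtain x where x: "x \<noteq> 0" "p = vec.span {x}" using p points by (metis subsetD proj_points_iff)
        then have GW: "G \<inter> latin_plane p = lines_through x \<inter> lines_within a"
          using 2 by (auto simp: latin_plane_eq_lines_through)
        have "vec.subspace (lines_through x \<inter> lines_within a)"
          by (intro vec.subspace_inter subspace_lines_through subspace_lines_within)
        then show ?thesis
          unfolding GW count[OF \<open>vec.subspace _\<close>] card_lines_through_Int_lines_within[OF x(1) 2(1)]
          using geometric by (simp add: x(2) span_singleton_subset_annihilator_iff flip: Q_def)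
      qed
      then have "(\<Sum>p\<in>P0. count (G \<inter> latin_plane p)) = real (card {p \<in> P0. p \<subseteq> annihilator a}) * (Q + 1)"
        by (simp add: sum.If_cases Int_def)
      moreover have "annihilator a \<in> proj_planes" using 2(1) proj_planes_iff by blast
      then have "real (card {p \<in> P0. p \<subseteq> annihilator a}) = real m + (if annihilator a \<in> P2 then Q else 0)"
        using two_intersections[of "annihilator a"] by (auto simp: P2_def Q_def)
      moreover have "real (card P0) = real m * (Q + 1)" by (simp add: card_P0 Q_def algebra_simps)
      ultimately have "(\<Sum>p\<in>P0. count (G \<inter> latin_plane p)) - real (card P0) =
          (if annihilator a \<in> P2 then Q * (Q + 1) else 0)"
        by (simp add: algebra_simps)
      then show ?thesis
        unfolding sum_eq using 2 Q by (simp add: indicator_def lines_within_in_L_iff \<alpha>_def)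
    qed
  qed
  then show ?thesis unfolding cameron_liebler_def using L_subset_generators by blast
qed

end

section \<open>A scattered linear set with two intersection numbers\<close>

lemma finite_field_power_CARD:
  fixes x :: "'f::{field,finite}"
  shows "x ^ CARD('f) = x"
proof (cases "x = 0")
  case False
  have "(\<Prod>y\<in>UNIV - {0}. x * y) = (\<Prod>y\<in>UNIV - {0}. y)"
    by (rule prod.reindex_bij_witness[of _ "\<lambda>y. y / x" "\<lambda>y. x * y"]) (use False in auto)
  moreover have "(\<Prod>y\<in>UNIV - {0 :: 'f}. y) \<noteq> 0" by simp
  ultimately have "x ^ (CARD('f) - 1) = 1"
    by (simp add: prod.distrib card_Diff_singleton)
  moreover have "x ^ CARD('f) = x * x ^ (CARD('f) - 1)"
    using CARD_field_gt_1[where 'k='f] by (simp flip: power_Suc)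
  ultimately show ?thesis by simp
qed (use CARD_field_gt_1[where 'k='f] in simp)

text \<open>
  The prime below \<open>q\<close> is the characteristic, because the characteristic divides \<open>CARD('k)\<close>.
\<close>
lemma power_prime_power_add:
  fixes x y :: "'k::{field,finite}"
  assumes "primepow q" "CARD('k) = q ^ t"
  shows "(x + y) ^ q = x ^ q + y ^ q"
proof -
  from assms(1) obtain p n where p: "prime p" "q = p ^ n" unfolding primepow_def by auto
  have "prime CHAR('k)"
    using prime_CHAR_semidom[where 'a='k] finite_imp_CHAR_pos[where 'a='k] by simp
  moreover have "CHAR('k) dvd p ^ (n * t)"
    using CHAR_dvd_CARD[where 'a='k] assms(2) p(2) by (simp add: power_mult)
  ultimately have "CHAR('k) = p"
    using p(1) by (metis prime_dvd_power primes_dvd_imp_eq)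
  then show ?thesis using freshmans_dream'[OF \<open>prime CHAR('k)\<close>, of q n] p(2) by simp
qed

lemma card_kernel_binomial_le:
  fixes b c :: "'k::{field,finite}"
  assumes "q > 1" "b \<noteq> 0 \<or> c \<noteq> 0"
  shows "card {x. b * x + c * x ^ q = 0} \<le> q"
proof -
  define p where "p = Polynomial.monom b 1 + Polynomial.monom c q"
  have "Polynomial.coeff p 1 = b" "Polynomial.coeff p q = c" using assms(1) by (simp_all add: p_def)
  then have "p \<noteq> 0" using assms(2) by auto
  then have "card {x. poly p x = 0} \<le> degree p" by (rule card_poly_roots_bound)
  also have "degree p \<le> q"
    unfolding p_def using assms(1)
    by (intro degree_add_le order_trans[OF degree_monom_le]) auto
  finally show ?thesis by (simp add: p_def poly_monom)
qed

text \<open>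
  The vectors \<open>(x, x ^ q)\<close> define a scattered linear set of pseudoregulus type on a line; this is the
  direct sum of two copies on skew lines.
\<close>
definition frobenius_graph :: "nat \<Rightarrow> ('k::field ^ 4) set" where
  "frobenius_graph q = {vec4 x (x ^ q) y (y ^ q) | x y. True}"

lemma vec4_in_frobenius_graph [intro]: "vec4 x (x ^ q) y (y ^ q) \<in> frobenius_graph q"
  by (auto simp: frobenius_graph_def)

lemma frobenius_graph_iff: "v \<in> frobenius_graph q \<longleftrightarrow> v $ 1 = (v $ 0) ^ q \<and> v $ 3 = (v $ 2) ^ q"
  by (auto simp: frobenius_graph_def vec4_eq_iff)

context
  fixes \<iota> :: "'f::{field,finite} \<Rightarrow> 'k::{field,finite}" and q t :: nat
  assumes q: "primepow q" and card_f: "CARD('f) = q" and card_k: "CARD('k) = q ^ t"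
    and \<iota>: "field_embedding \<iota>"
begin

abbreviation (input) U :: "('k ^ 4) set" where "U \<equiv> frobenius_graph q"

interpretation F: vector_space "scale_via \<iota> :: 'f \<Rightarrow> 'k ^ 4 \<Rightarrow> 'k ^ 4"
  using \<iota> by (rule vector_space_scale_via)

lemma q_gt_1: "q > 1"
  using CARD_field_gt_1[where 'k='f] card_f by simp

lemma inj_iota: "inj \<iota>"
proof (rule injI, rule ccontr)
  fix a b assume eq: "\<iota> a = \<iota> b" and "a \<noteq> b"
  have hom: "\<iota> 1 = 1" "\<iota> (x + y) = \<iota> x + \<iota> y" "\<iota> (x * y) = \<iota> x * \<iota> y" for x y
    using \<iota> by (auto simp: field_embedding_def)
  have "\<iota> (a - b) = 0" using hom(2)[of "a - b" b] eq by simp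
  then have "\<iota> ((a - b) * inverse (a - b)) = 0" by (simp add: hom)
  then show False using \<open>a \<noteq> b\<close> hom(1) by simp
qed

lemma frobenius_fixed: "{z :: 'k. z ^ q = z} = range \<iota>"
proof -
  have pow: "\<iota> (a ^ n) = \<iota> a ^ n" for a n
    using \<iota> by (induction n) (auto simp: field_embedding_def)
  have sub: "range \<iota> \<subseteq> {z. z ^ q = z}"
    using pow[of _ q] finite_field_power_CARD[where 'f='f] card_f by auto
  have "{z :: 'k. z ^ q = z} = {z. - 1 * z + 1 * z ^ q = 0}" by auto
  then have "card {z :: 'k. z ^ q = z} \<le> q"
    using card_kernel_binomial_le[OF q_gt_1, of "- 1 :: 'k" 1] by simp
  also have "q = card (range \<iota>)" using inj_iota by (simp add: card_image card_f)
  finally show ?thesis by (intro card_seteq[symmetric] sub) auto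
qed

lemma frobenius_add: "(x + y :: 'k) ^ q = x ^ q + y ^ q"
  by (rule power_prime_power_add[OF q card_k])

lemma frobenius_iota: "\<iota> a ^ q = \<iota> a"
  using frobenius_fixed by blast

lemma subspace_U: "F.subspace U"
  unfolding F.subspace_def using q_gt_1
  by (auto simp: frobenius_graph_iff frobenius_add scale_via_def power_mult_distrib frobenius_iota)

lemma card_U: "card U = q ^ (2 * t)"
proof -
  have "U = (\<lambda>(x, y). vec4 x (x ^ q) y (y ^ q)) ` UNIV"
    by (auto simp: frobenius_graph_def image_def)
  moreover have "inj (\<lambda>(x, y). vec4 x (x ^ q) y (y ^ q :: 'k))"
    by (auto simp: inj_def vec4_eq_iff)
  ultimately have "card U = CARD('k \<times> 'k)" by (simp add: card_image)
  then show ?thesis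
    by (simp add: card_k power_add mult_2 card_cartesian_product flip: UNIV_Times_UNIV)
qed

lemma dim_U: "F.dim U = 2 * t"
proof -
  have "q ^ (2 * t) = q ^ F.dim U"
    using F.card_subspace[OF _ subspace_U] by (simp add: card_U card_f)
  then show ?thesis using power_inject_exp[OF q_gt_1] by simp
qed

text \<open>
  Some coordinate \<open>x\<close> of \<open>u\<close> that is followed by \<open>x ^ q\<close> is nonzero, and \<open>(k * x) ^ q = k * x ^ q\<close>
  forces \<open>k ^ q = k\<close>.
\<close>
lemma U_Int_span_singleton:
  assumes "u \<in> U" "u \<noteq> 0"
  shows "U \<inter> vec.span {u} = (\<lambda>a. \<iota> a *s u) ` UNIV"
proof -
  have "k *s u \<in> U \<longleftrightarrow> k \<in> range \<iota>" for k
  proof -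
    have "u $ 0 \<noteq> 0 \<or> u $ 2 \<noteq> 0"
    proof (rule ccontr)
      assume "\<not> ?thesis"
      then show False using assms q_gt_1 by (simp add: frobenius_graph_iff vec4_eq_iff)
    qed
    then have "k *s u \<in> U \<longleftrightarrow> k ^ q = k"
      using assms q_gt_1 by (auto simp: frobenius_graph_iff power_mult_distrib)
    then show ?thesis using frobenius_fixed by auto
  qed
  then show ?thesis by (auto simp: vec.span_singleton)
qed

lemma scattered_U:
  assumes "S \<in> proj_points"
  shows "F.dim (U \<inter> S) \<le> 1"
proof (cases "U \<inter> S \<subseteq> {0}")
  case True
  then have "F.dim (U \<inter> S) \<le> card ({} :: ('k ^ 4) set)"
    by (intro F.dim_le_card) auto
  then show ?thesis by simp
next
  case False
  then obtain u where u: "u \<in> U" "u \<in> S" "u \<noteq> 0" by blast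
  obtain s where s: "s \<noteq> 0" "S = vec.span {s}" using assms proj_points_iff by blast
  then have "S = vec.span {u}" using u span_singleton_eq_iff by metis
  then have "U \<inter> S = range (\<lambda>a. scale_via \<iota> a u)"
    using U_Int_span_singleton[OF u(1,3)] by (simp add: scale_via_def)
  then have "U \<inter> S \<subseteq> F.span {u}" by (simp add: F.span_singleton)
  then have "F.dim (U \<inter> S) \<le> card {u}" by (rule F.dim_le_card) simp
  then show ?thesis by simp
qed

lemma scattered_linear_set_U: "scattered_linear_set \<iota> (2 * t) (linear_set U)"
  unfolding scattered_linear_set_def using subspace_U dim_U scattered_U by blast

lemma card_points_of_U:
  assumes "vec.subspace E"
  shows "card {P \<in> linear_set U. P \<subseteq> E} * (q - 1) = card (U \<inter> E) - 1"
  unfolding points_in_subspace_linear_set[OF assms]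
proof (rule card_linear_set)
  show "0 \<in> U \<inter> E" using assms vec.subspace_0 F.subspace_0[OF subspace_U] by blast
  fix u assume u: "u \<in> U \<inter> E" "u \<noteq> 0"
  have "vec.span {u} \<subseteq> E" using u assms by (simp add: vec.span_minimal)
  then have "U \<inter> E \<inter> vec.span {u} = (\<lambda>a. \<iota> a *s u) ` UNIV"
    using U_Int_span_singleton u by blast
  also have "\<dots> = (\<lambda>k. k *s u) ` range \<iota>" by (simp add: image_comp comp_def)
  also have "card \<dots> = card (range \<iota>)"
    using u(2) by (intro card_image inj_onI) simp
  also have "\<dots> = q" using inj_iota by (simp add: card_image card_f)
  finally show "card (U \<inter> E \<inter> vec.span {u}) = q" .
qed

text \<open>
  The intersection is the kernel of the map \<open>pairing a\<close> on \<open>U\<close>, linear over the small field. Its image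
  lies in \<open>'k\<close>, and it contains the image of some nonzero map taking \<open>x\<close> to \<open>b * x + c * x ^ q\<close>, whose
  kernel has at most \<open>q\<close> elements. So the order of the kernel of \<open>pairing a\<close>, a power of \<open>q\<close>, is
  squeezed between \<open>q ^ t\<close> and \<open>q ^ (t + 1)\<close>.
\<close>
lemma card_U_Int_annihilator:
  assumes "a \<noteq> 0"
  shows "card (U \<inter> annihilator a) = q ^ t \<or> card (U \<inter> annihilator a) = q ^ (t + 1)"
proof -
  have sub: "F.subspace (U \<inter> annihilator a)"
    using subspace_annihilator[of a]
    by (intro F.subspace_inter subspace_U)
      (auto simp: F.subspace_def vec.subspace_def scale_via_def)
  define d where "d = F.dim (U \<inter> annihilator a)"
  have d: "card (U \<inter> annihilator a) = q ^ d"
    using F.card_subspace[OF _ sub] by (simp add: card_f d_def)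
  have "card U = card (pairing a ` U) * card {u \<in> U. pairing a u = 0}"
    using subspace_U
    by (intro card_additive_kernel_image) (auto simp: pairing_simps F.subspace_add F.subspace_diff)
  then have U: "q ^ (2 * t) = card (pairing a ` U) * q ^ d"
    by (simp add: card_U d[symmetric] annihilator_def Int_def)
  have "card (pairing a ` U) \<le> q ^ t"
    using card_mono[of UNIV "pairing a ` U"] by (simp add: card_k)
  then have "q ^ t * q ^ t \<le> q ^ t * q ^ d"
    using mult_le_mono1[of "card (pairing a ` U)" "q ^ t" "q ^ d"] U by (simp add: mult_2 power_add)
  then have lower: "t \<le> d" using q_gt_1 by (simp add: power_increasing_iff)
  have image_ge: "q ^ t \<le> card (pairing a ` U) * q"
    if "b \<noteq> 0 \<or> c \<noteq> 0" "range (\<lambda>x. b * x + c * x ^ q) \<subseteq> pairing a ` U" for b c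
  proof -
    define g where "g x = b * x + c * x ^ q" for x
    have "CARD('k) = card (range g) * card {x \<in> UNIV. g x = 0}"
      by (rule card_additive_kernel_image) (simp_all add: g_def frobenius_add algebra_simps)
    also have "\<dots> \<le> card (pairing a ` U) * q"
      using card_kernel_binomial_le[OF q_gt_1 that(1)] that(2)
      by (intro mult_le_mono card_mono) (simp_all add: g_def)
    finally show ?thesis by (simp add: card_k)
  qed
  have "q ^ t \<le> card (pairing a ` U) * q"
  proof (cases "a $ 0 \<noteq> 0 \<or> a $ 1 \<noteq> 0")
    case True
    have "a $ 0 * x + a $ 1 * x ^ q = pairing a (vec4 x (x ^ q) 0 (0 ^ q))" for x
      using q_gt_1 by (simp add: pairing_def)
    then show ?thesis by (intro image_ge[OF True]) auto
  next
    case False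
    then have "a $ 2 \<noteq> 0 \<or> a $ 3 \<noteq> 0" using assms by (auto simp: vec4_eq_iff)
    moreover have "a $ 2 * x + a $ 3 * x ^ q = pairing a (vec4 0 (0 ^ q) x (x ^ q))" for x
      using q_gt_1 by (simp add: pairing_def)
    ultimately show ?thesis by (intro image_ge) auto
  qed
  then have "q ^ t * q ^ d \<le> card (pairing a ` U) * q * q ^ d" by (rule mult_le_mono1)
  also have "\<dots> = card (pairing a ` U) * q ^ d * q" by (simp add: mult_ac)
  also have "\<dots> = q ^ t * q ^ (t + 1)"
    unfolding U[symmetric] by (simp add: mult_2 power_add)
  finally have "d \<le> t + 1" using q_gt_1 by (simp add: power_increasing_iff del: power_Suc)
  then have "d = t \<or> d = t + 1" using lower by linarith
  then show ?thesis using d by auto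
qed

end

theorem theorem3p8:
  fixes \<iota> :: "'f::{field,finite} \<Rightarrow> 'k::{field,finite}" and q t :: nat
  assumes "primepow q" and "t \<ge> 2"
    and "CARD('f) = q" and "CARD('k) = q ^ t"
    and "field_embedding \<iota>"
  shows "\<exists>P0 :: ('k ^ 4) set set. scattered_linear_set \<iota> (2 * t) P0 \<and>
    (let P2 = {E \<in> proj_planes. real (card {P \<in> P0. P \<subseteq> E}) = (real q ^ (t + 1) - 1) / (real q - 1)};
         \<L> = latin_plane ` P0 \<union> greek_plane ` P2
     in cameron_liebler \<L> \<and> has_parameter \<L> ((real q ^ t - 1) / (real q - 1)))"
proof -
  note setting = assms(1,3-5)
  define P0 where "P0 = linear_set (frobenius_graph q :: ('k ^ 4) set)"
  define Q where "Q = q ^ t"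
  have q: "real q > 1" using q_gt_1[OF setting] by simp
  define m where "m = (\<Sum>i<t. q ^ i)"
  have m: "real m * (real q - 1) = real Q - 1"
    unfolding m_def Q_def using power_diff_1_eq[of "real q" t] by (simp add: mult.commute)
  have points: "real (card {P \<in> P0. P \<subseteq> E}) * (real q - 1) = real (card (frobenius_graph q \<inter> E)) - 1"
    if E: "vec.subspace E" for E
  proof -
    have "0 \<in> frobenius_graph q \<inter> E"
      using q E vec.subspace_0 by (auto simp: frobenius_graph_iff)
    then have "card (frobenius_graph q \<inter> E) \<ge> 1"
      by (metis One_nat_def Suc_leI card_gt_0_iff empty_iff finite)
    then show ?thesis
      using arg_cong[OF card_points_of_U[OF setting E], of real] q by (simp add: P0_def of_nat_diff)
  qed
  have "card P0 = m * (Q + 1)"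
  proof -
    have "real (card P0) * (real q - 1) = (real Q)\<^sup>2 - 1"
      using points[OF vec.subspace_UNIV] card_U[OF setting]
      by (simp add: Q_def mult.commute flip: power_mult)
    also have "\<dots> = real m * (real q - 1) * (real Q + 1)"
      unfolding m by (simp add: power2_eq_square algebra_simps)
    finally have "real (card P0) = real m * (real Q + 1)" using q by simp
    then have "real (card P0) = real (m * (Q + 1))" by (simp add: distrib_left)
    then show ?thesis unfolding of_nat_eq_iff .
  qed
  moreover have "card {P \<in> P0. P \<subseteq> E} = m \<or> card {P \<in> P0. P \<subseteq> E} = m + Q" if E: "E \<in> proj_planes" for E
  proof -
    obtain a where a: "a \<noteq> 0" "E = annihilator a" using E proj_planes_iff by blast
    let ?N = "card {P \<in> P0. P \<subseteq> E}"
    have N: "real ?N * (real q - 1) = real (card (frobenius_graph q \<inter> E)) - 1"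
      using points[OF subspace_annihilator] a(2) by simp
    from card_U_Int_annihilator[OF setting a(1)] show ?thesis
    proof
      assume "card (frobenius_graph q \<inter> annihilator a) = q ^ t"
      then have "real ?N * (real q - 1) = real m * (real q - 1)" using N m a(2) by (simp add: Q_def)
      then show ?thesis using q by simp
    next
      assume "card (frobenius_graph q \<inter> annihilator a) = q ^ (t + 1)"
      then have "real ?N * (real q - 1) = real q * real Q - 1" using N a(2) by (simp add: Q_def)
      also have "\<dots> = real (m + Q) * (real q - 1)" using m by (simp add: algebra_simps)
      finally have "real ?N = real (m + Q)" using q by simp
      then show ?thesis unfolding of_nat_eq_iff by simp
    qed
  qed
  moreover have "P0 \<subseteq> proj_points"
    unfolding P0_def by (rule linear_set_subset_proj_points)
  moreover have "real n = (real q ^ (t + 1) - 1) / (real q - 1) \<longleftrightarrow> n = m + Q" for n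
  proof -
    have "(real q ^ (t + 1) - 1) / (real q - 1) = real (m + Q)"
      using q m by (simp add: Q_def field_simps)
    then show ?thesis by (simp only: of_nat_eq_iff)
  qed
  moreover have "(real q ^ t - 1) / (real q - 1) = real m"
    using q m by (simp add: Q_def field_simps)
  moreover have "Q = CARD('k)" using assms(4) by (simp add: Q_def)
  ultimately show ?thesis
    using cameron_liebler_L[of P0 m] has_parameter_L[of P0 m] scattered_linear_set_U[OF setting]
    by (intro exI[of _ P0]) (simp add: Let_def P0_def)
qed

end
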